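(* Let $\Lambda$ be a relatively-separated subset of $\mathbb{R}^d$, and let $\Phi=\{\phi_\lambda,\ \lambda\in\Lambda\}$ be a family of functions on $\mathbb{R}^d$ with the property that $$\Big\|\sup_{\lambda\in\Lambda}|\phi_\lambda(\cdot+\lambda)|\,\Big\|_{\mathcal{W}_1}<\infty$$ and $$\lim_{\delta\to0}\Big\|\sup_{\lambda\in\Lambda}|\omega_\delta(\phi_\lambda)(\cdot+\lambda)|\,\Big\|_{\mathcal{W}_1}=0.$$ If the synthesis operator $S_\Phi$ has $\ell^p$-stability for some $1\le p\le\infty$, then it has $\ell^q$-stability for any $1\le q\le\infty$.
   Context: A discrete subset $\Lambda$ of $\mathbb{R}^d$ is relatively-separated if $R(\Lambda)=\sup_{x\in\mathbb{R}^d}\sum_{\lambda\in\Lambda}\chi_{\lambda+[0,1)^d}(x)<\infty$, where $\chi_E$ is the characteristic function of $E$. The modulus of continuity of a function $f$ on $\mathbb{R}^d$ is $\omega_\delta(f)(x)=\sup_{|y|\le\delta}|f(x+y)-f(x)|$, $|\cdot|$ the Euclidean norm. The Wiener amalgam norm on $\mathbb{R}^d$ is $\|\phi\|_{\mathcal{W}_1}=\sum_{k\in\mathbb{Z}^d}\sup_{x\in[0,1)^d}|\phi(k+x)|$. The synthesis operator is $S_\Phi:\ \ell^p(\Lambda)\ni(c(\lambda))_{\lambda\in\Lambda}\mapsto\sum_{\lambda\in\Lambda}c(\lambda)\phi_\lambda$, with values in $V_p(\Phi,\Lambda):=\{\sum_{\lambda\in\Lambda}c(\lambda)\phi_\lambda:\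 (c(\lambda))_{\lambda\in\Lambda}\in\ell^p(\Lambda)\}\subset L^p(\mathbb{R}^d)$. It has $\ell^p$-stability if there exists a positive constant $C$ such that $C^{-1}\|c\|_{\ell^p(\Lambda)}\le\|S_\Phi c\|_p\le C\|c\|_{\ell^p(\Lambda)}$ for all $c\in\ell^p(\Lambda)$, where $\|\cdot\|_p$ is the norm of $L^p(\mathbb{R}^d)$. *)

theory Defs
  imports "HOL-Analysis.Analysis" "HOL-Probability.Essential_Supremum"
begin

definition half_open_cube :: "(real ^ 'd) set" where
  "half_open_cube = {x. \<forall>i. 0 \<le> x $ i \<and> x $ i < 1}"

definition integer_lattice :: "(real ^ 'd) set" where
  "integer_lattice = {k. \<forall>i. k $ i \<in> \<int>}"

definition separation_number :: "(real ^ 'd) set \<Rightarrow> ennreal" where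
  "separation_number \<Lambda> =
     (SUP x. \<Sum>\<^sub>\<infinity>l\<in>\<Lambda>. indicator ((+) l ` half_open_cube) x)"

definition relatively_separated :: "(real ^ 'd) set \<Rightarrow> bool" where
  "relatively_separated \<Lambda> \<longleftrightarrow> discrete \<Lambda> \<and> separation_number \<Lambda> < \<infinity>"

definition modulus_of_continuity ::
    "real \<Rightarrow> (real ^ 'd \<Rightarrow> complex) \<Rightarrow> real ^ 'd \<Rightarrow> ennreal" where
  "modulus_of_continuity \<delta> f x = (SUP y\<in>{y. norm y \<le> \<delta>}. ennreal (norm (f (x + y) - f x)))"

(* The norm is only ever taken of functions with values in [0, infinity] (suprema of absolute
   values), so the argument is ennreal-valued and carries no absolute value. *)
definition wiener_amalgam_norm :: "(real ^ 'd \<Rightarrow> ennreal) \<Rightarrow> ennreal" where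
  "wiener_amalgam_norm g = (\<Sum>\<^sub>\<infinity>k\<in>integer_lattice. SUP x\<in>half_open_cube. g (k + x))"

(* The L^p(M) norm for an exponent p in [1, infinity]. Non-measurable functions get norm infinity
   (as in esssup), so that a finite norm means membership in L^p(M). With M = count_space \<Lambda> this is
   the norm of l^p(\<Lambda>); sequences are then functions whose values off \<Lambda> are irrelevant. *)
definition Lp_norm :: "'a measure \<Rightarrow> ennreal \<Rightarrow> ('a \<Rightarrow> complex) \<Rightarrow> ennreal" where
  "Lp_norm M p f =
    (if f \<notin> borel_measurable M then \<infinity>
     else if p = \<infinity> then esssup M (\<lambda>x. ennreal (norm (f x)))
     else let I = (\<integral>\<^sup>+x. ennreal (norm (f x) powr enn2real p) \<partial>M)
          in if I = \<infinity> then \<infinity> else ennreal (enn2real I powr (1 / enn2real p)))"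

definition Lp_space :: "'a measure \<Rightarrow> ennreal \<Rightarrow> ('a \<Rightarrow> complex) set" where
  "Lp_space M p = {f. Lp_norm M p f < \<infinity>}"

(* The series is an unconditional pointwise sum. For \<Phi> with finite Wiener amalgam norm as in the
   theorem, \<Lambda> relatively separated and c bounded, it converges absolutely at every point. *)
definition synthesis_operator ::
    "(real ^ 'd) set \<Rightarrow> (real ^ 'd \<Rightarrow> real ^ 'd \<Rightarrow> complex) \<Rightarrow>
     (real ^ 'd \<Rightarrow> complex) \<Rightarrow> real ^ 'd \<Rightarrow> complex" where
  "synthesis_operator \<Lambda> \<phi> c x = (\<Sum>\<^sub>\<infinity>l\<in>\<Lambda>. c l * \<phi> l x)"

definition lp_stable ::
    "(real ^ 'd) set \<Rightarrow> (real ^ 'd \<Rightarrow> real ^ 'd \<Rightarrow> complex) \<Rightarrow> ennreal \<Rightarrow> bool" where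
  "lp_stable \<Lambda> \<phi> p \<longleftrightarrow>
    (\<exists>C::real. C > 0 \<and> (\<forall>c\<in>Lp_space (count_space \<Lambda>) p.
       ennreal (inverse C) * Lp_norm (count_space \<Lambda>) p c
         \<le> Lp_norm lborel p (synthesis_operator \<Lambda> \<phi> c) \<and>
       Lp_norm lborel p (synthesis_operator \<Lambda> \<phi> c)
         \<le> ennreal C * Lp_norm (count_space \<Lambda>) p c))"

end

theory Submission
  imports Defs
begin

text \<open>
  Cut \<open>\<real>\<^sup>d\<close> into unit cells indexed by \<open>\<int>\<^sup>d\<close> and replace a sequence \<open>c\<close> and the function \<open>f = S c\<close> by
  their cellwise suprema \<open>u\<close> and \<open>h\<close>. The Wiener amalgam hypothesis turns synthesis into domination by
  a convolution with a summable kernel \<open>W\<close> on \<open>\<int>\<^sup>d\<close>, which gives the upper estimates.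

  For the lower estimate, apply \<open>p\<close>-stability to \<open>c\<close> multiplied by the windows
  \<open>\<psi>(j - n) = exp (- |j - n| / N)\<close>. As \<open>|\<psi>(j + i) - \<psi>(j)| \<le> t\<^sub>i (\<psi>(j) + \<psi>(j + i))\<close> with
  \<open>t\<^sub>i = min 1 (|i| / N)\<close>, the local norms \<open>a\<^sub>n = \<parallel>\<psi>(\<cdot> - n) u\<parallel>\<^sub>p\<close> satisfy
  \<open>a\<^sub>n \<le> C (\<Sum>\<^sub>k \<psi>(k - n) h\<^sub>k + \<Sum>\<^sub>i W\<^sub>i t\<^sub>i (a\<^sub>n + a\<^bsub>n-i\<^esub>))\<close>. For large \<open>N\<close> the sum \<open>\<Sum>\<^sub>i W\<^sub>i t\<^sub>i\<close> is
  small, so after taking \<open>\<ell>\<^sup>q\<close> norms in \<open>n\<close> the last term is absorbed, and \<open>\<parallel>u\<parallel>\<^sub>q \<le> K \<parallel>h\<parallel>\<^sub>q\<close>.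
  Finally \<open>h\<close> is at most \<open>2 |f|\<close> plus an oscillation on a fixed portion of every cell, and
  the modulus of continuity hypothesis makes the oscillation a small multiple of \<open>\<parallel>u\<parallel>\<^sub>q\<close>, which is
  absorbed as well.
\<close>

section \<open>Bounds for sequence norms\<close>

lemma norm_summable_on_dominated:
  fixes f :: "'a \<Rightarrow> 'b::real_normed_vector" and g :: "'a \<Rightarrow> real"
  assumes "g summable_on A" "\<And>x. x \<in> A \<Longrightarrow> norm (f x) \<le> g x"
  shows "(\<lambda>x. norm (f x)) summable_on A"
proof (rule Infinite_Sum.abs_summable_on_comparison_test)
  show "(\<lambda>x. norm (g x)) summable_on A"
    using assms(1) summable_on_iff_abs_summable_on_real by blast
  show "norm (f x) \<le> norm (g x)" if "x \<in> A" for x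
    using assms(2)[OF that] by simp
qed

lemma summable_on_dominated:
  fixes f :: "'a \<Rightarrow> 'b::banach" and g :: "'a \<Rightarrow> real"
  assumes "g summable_on A" "\<And>x. x \<in> A \<Longrightarrow> norm (f x) \<le> g x"
  shows "f summable_on A"
  using norm_summable_on_dominated[OF assms] by (rule abs_summable_summable)

lemma norm_infsum_le_dominated:
  fixes f :: "'a \<Rightarrow> 'b::real_normed_vector" and g :: "'a \<Rightarrow> real"
  assumes "g summable_on A" "\<And>x. x \<in> A \<Longrightarrow> norm (f x) \<le> g x"
  shows "norm (infsum f A) \<le> infsum g A"
proof -
  note s = norm_summable_on_dominated[OF assms]
  have "norm (infsum f A) \<le> (\<Sum>\<^sub>\<infinity>x\<in>A. norm (f x))"
    by (rule norm_infsum_bound[OF s])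
  also have "\<dots> \<le> infsum g A"
    by (rule infsum_mono[OF s assms])
  finally show ?thesis .
qed

text \<open>On the open half-line this is convexity of the power. If one argument is zero, its term
  vanishes and what remains is \<open>c powr r \<le> c\<close> for the other weight \<open>c\<close>
  in (0, 1].\<close>

lemma powr_convex_nonneg:
  fixes a b x y r :: real
  assumes r: "1 \<le> r" and "0 \<le> x" "0 \<le> y" "0 < a" "0 < b" "a + b = 1"
  shows "(a * x + b * y) powr r \<le> a * x powr r + b * y powr r"
proof -
  have le: "c powr r \<le> c" if "0 < c" "c \<le> 1" for c :: real
    using powr_mono'[of 1 r c] that r by simp
  consider "x = 0" | "y = 0" | "0 < x" "0 < y"
    using assms by linarith
  then show ?thesis
  proof cases
    case 1
    then have "(a * x + b * y) powr r = b powr r * y powr r"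
      using assms by (simp add: powr_mult)
    also have "\<dots> \<le> b * y powr r"
      using le[of b] assms by (intro mult_right_mono) auto
    finally show ?thesis using 1 r by simp
  next
    case 2
    then have "(a * x + b * y) powr r = a powr r * x powr r"
      using assms by (simp add: powr_mult)
    also have "\<dots> \<le> a * x powr r"
      using le[of a] assms by (intro mult_right_mono) auto
    finally show ?thesis using 2 r by simp
  next
    case 3
    have a: "a = 1 - b" using assms by simp
    show ?thesis
      unfolding a using convex_onD[OF powr_convex[OF r], of b x y] assms 3 by simp
  qed
qed

text \<open>Since \<open>(u n + v n) / (S + T)\<close> is the convex combination of
  \<open>u n / S\<close> and \<open>v n / T\<close> with weights \<open>S / (S + T)\<close> and
  \<open>T / (S + T)\<close>, convexity of the power applies term by term and is then summed; no
  dual exponent enters. A zero radius forces the corresponding sequence to vanish on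
  \<open>F\<close>.\<close>

lemma minkowski_sum_powr:
  fixes u v :: "'i \<Rightarrow> real"
  assumes r: "1 \<le> r" and fin: "finite F"
    and nn: "\<And>n. 0 \<le> u n" "\<And>n. 0 \<le> v n" "0 \<le> S" "0 \<le> T"
    and u: "(\<Sum>n\<in>F. u n powr r) \<le> S powr r"
    and v: "(\<Sum>n\<in>F. v n powr r) \<le> T powr r"
  shows "(\<Sum>n\<in>F. (u n + v n) powr r) \<le> (S + T) powr r"
proof -
  have zero: "w n = 0" if "(\<Sum>n\<in>F. w n powr r) \<le> 0 powr r" "n \<in> F" for w :: "'i \<Rightarrow> real" and n
  proof -
    have "(\<Sum>n\<in>F. w n powr r) = 0"
      using that(1) sum_nonneg[of F "\<lambda>n. w n powr r"] by simp
    then show ?thesis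
      using that(2) fin by (subst (asm) sum_nonneg_eq_0_iff) auto
  qed
  consider "S = 0" | "T = 0" | "0 < S" "0 < T"
    using nn by linarith
  then show ?thesis
  proof cases
    case 1
    then show ?thesis using zero[of u] u v by (simp cong: sum.cong)
  next
    case 2
    then show ?thesis using zero[of v] u v by (simp cong: sum.cong)
  next
    case 3
    define a b where "a = S / (S + T)" and "b = T / (S + T)"
    have ab: "0 < a" "0 < b" "a + b = 1"
      using 3 by (auto simp: a_def b_def add_divide_distrib[symmetric])
    have S: "S = a * (S + T)" and T: "T = b * (S + T)"
      using 3 by (auto simp: a_def b_def)
    have "(u n + v n) powr r
        \<le> (S + T) powr r * (a * (u n powr r / S powr r) + b * (v n powr r / T powr r))" for n
    proof -
      have "a * (u n / S) + b * (v n / T) = (u n + v n) / (S + T)"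
        using 3 by (simp add: a_def b_def add_divide_distrib)
      then have "u n + v n = (S + T) * (a * (u n / S) + b * (v n / T))"
        using 3 by simp
      then have "(u n + v n) powr r = (S + T) powr r * (a * (u n / S) + b * (v n / T)) powr r"
        using 3 nn ab by (simp add: powr_mult)
      also have "\<dots> \<le> (S + T) powr r * (a * (u n / S) powr r + b * (v n / T) powr r)"
        using 3 nn ab r by (intro mult_left_mono powr_convex_nonneg) auto
      finally show ?thesis using 3 nn by (simp add: powr_divide)
    qed
    then have "(\<Sum>n\<in>F. (u n + v n) powr r)
        \<le> (\<Sum>n\<in>F. (S + T) powr r * (a * (u n powr r / S powr r) + b * (v n powr r / T powr r)))"
      by (rule sum_mono)
    also have "\<dots> = (S + T) powr r * (a * ((\<Sum>n\<in>F. u n powr r) / S powr r)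
        + b * ((\<Sum>n\<in>F. v n powr r) / T powr r))"
      by (simp only: sum_distrib_left sum.distrib sum_divide_distrib distrib_left)
    also have "\<dots> \<le> (S + T) powr r * (a * 1 + b * 1)"
      using 3 u v ab by (intro mult_left_mono add_mono) (auto simp: divide_le_eq)
    finally show ?thesis using ab by simp
  qed
qed

text \<open>
  Expresses \<open>\<parallel>u\<parallel>\<^sub>q \<le> S\<close>. Finite partial sums make the bound stable under pointwise limits and free
  of summability side conditions.
\<close>

definition lq_bounded :: "ennreal \<Rightarrow> ('i \<Rightarrow> real) \<Rightarrow> real \<Rightarrow> bool" where
  "lq_bounded q u S \<longleftrightarrow> 0 \<le> S \<and>
    (if q = \<infinity> then \<forall>n. \<bar>u n\<bar> \<le> S
     else \<forall>F. finite F \<longrightarrow> (\<Sum>n\<in>F. \<bar>u n\<bar> powr enn2real q) \<le> S powr enn2real q)"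

lemma enn2real_ge_1: "1 \<le> q \<Longrightarrow> q \<noteq> \<infinity> \<Longrightarrow> 1 \<le> enn2real q"
  by (metis enn2real_1 enn2real_mono infinity_ennreal_def top.not_eq_extremum)

lemma lq_bounded_nonneg: "lq_bounded q u S \<Longrightarrow> 0 \<le> S"
  by (simp add: lq_bounded_def)

lemma lq_bounded_mono:
  assumes "lq_bounded q u S" "1 \<le> q" "\<And>n. \<bar>v n\<bar> \<le> \<bar>u n\<bar>" "S \<le> T"
  shows "lq_bounded q v T"
proof (cases "q = \<infinity>")
  case True
  have "\<bar>v n\<bar> \<le> T" for n
  proof -
    have "\<bar>u n\<bar> \<le> S" using assms(1) True by (simp add: lq_bounded_def)
    then show ?thesis using assms(3)[of n] assms(4) by linarith
  qed
  then show ?thesis using assms(1,4) True by (simp add: lq_bounded_def)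
next
  case False
  note r = enn2real_ge_1[OF assms(2) False]
  have "(\<Sum>n\<in>F. \<bar>v n\<bar> powr enn2real q) \<le> T powr enn2real q" if "finite F" for F
  proof -
    have "(\<Sum>n\<in>F. \<bar>v n\<bar> powr enn2real q) \<le> (\<Sum>n\<in>F. \<bar>u n\<bar> powr enn2real q)"
      using assms(3) r by (intro sum_mono powr_mono2) auto
    also have "\<dots> \<le> S powr enn2real q"
      using assms(1) False that by (simp add: lq_bounded_def)
    also have "\<dots> \<le> T powr enn2real q"
      using assms(1,4) r by (intro powr_mono2) (auto simp: lq_bounded_def)
    finally show ?thesis .
  qed
  then show ?thesis using assms(1,4) False by (simp add: lq_bounded_def)
qed

lemma lq_bounded_point:
  assumes "lq_bounded q u S" "1 \<le> q"
  shows "\<bar>u n\<bar> \<le> S"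
proof (cases "q = \<infinity>")
  case False
  note r = enn2real_ge_1[OF assms(2) False]
  have "(\<Sum>n\<in>{n}. \<bar>u n\<bar> powr enn2real q) \<le> S powr enn2real q"
    using assms False unfolding lq_bounded_def by (meson finite.intros)
  then have "\<bar>u n\<bar> powr enn2real q \<le> S powr enn2real q"
    by simp
  then show ?thesis
    using powr_less_mono2[of "enn2real q" S "\<bar>u n\<bar>"] r lq_bounded_nonneg[OF assms(1)] by linarith
qed (use assms in \<open>simp add: lq_bounded_def\<close>)

lemma lq_bounded_add:
  assumes "lq_bounded q u S" "lq_bounded q v T" "1 \<le> q"
  shows "lq_bounded q (\<lambda>n. u n + v n) (S + T)"
proof (cases "q = \<infinity>")
  case True
  have "\<bar>u n + v n\<bar> \<le> S + T" for n
    using lq_bounded_point[OF assms(1,3), of n] lq_bounded_point[OF assms(2,3), of n] by linarith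
  then show ?thesis using assms True by (auto simp: lq_bounded_def)
next
  case False
  note r = enn2real_ge_1[OF assms(3) False]
  have "lq_bounded q (\<lambda>n. \<bar>u n\<bar> + \<bar>v n\<bar>) (S + T)"
    using assms False r minkowski_sum_powr[OF r, of _ "\<lambda>n. \<bar>u n\<bar>" "\<lambda>n. \<bar>v n\<bar>" S T]
    by (auto simp: lq_bounded_def)
  then show ?thesis
    by (rule lq_bounded_mono) (use assms in auto)
qed

lemma lq_bounded_cmult:
  assumes "lq_bounded q u S" "1 \<le> q" "0 \<le> c"
  shows "lq_bounded q (\<lambda>n. c * u n) (c * S)"
proof (cases "q = \<infinity>")
  case True
  then show ?thesis using assms by (auto simp: lq_bounded_def abs_mult intro!: mult_left_mono)
next
  case False
  have "(\<Sum>n\<in>F. \<bar>c * u n\<bar> powr enn2real q) \<le> (c * S) powr enn2real q" if "finite F" for F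
  proof -
    have "(\<Sum>n\<in>F. \<bar>c * u n\<bar> powr enn2real q) = c powr enn2real q * (\<Sum>n\<in>F. \<bar>u n\<bar> powr enn2real q)"
      using assms by (simp add: abs_mult powr_mult sum_distrib_left)
    also have "\<dots> \<le> c powr enn2real q * S powr enn2real q"
      using assms that False by (intro mult_left_mono) (auto simp: lq_bounded_def)
    finally show ?thesis using assms by (simp add: powr_mult lq_bounded_nonneg)
  qed
  then show ?thesis using assms False by (auto simp: lq_bounded_def)
qed

lemma lq_bounded_0: "lq_bounded q (\<lambda>n. 0) 0"
  by (simp add: lq_bounded_def)

lemma lq_bounded_sum:
  assumes "finite I" "1 \<le> q" "\<And>i. i \<in> I \<Longrightarrow> lq_bounded q (u i) (S i)"
  shows "lq_bounded q (\<lambda>n. \<Sum>i\<in>I. u i n) (\<Sum>i\<in>I. S i)"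
  using assms(1,3) by (induction I) (auto intro: lq_bounded_0 lq_bounded_add assms(2))

text \<open>A Fatou property: each inequality in the bound involves finitely many values and is
  continuous in them and in the radius. Infinite sums, the infimum of the admissible bounds and the
  absorption argument all rest on it.\<close>

lemma lq_bounded_limit:
  assumes q: "1 \<le> q" and \<F>: "\<F> \<noteq> bot"
    and b: "\<forall>\<^sub>F x in \<F>. lq_bounded q (u x) (S x)"
    and u: "\<And>n. ((\<lambda>x. u x n) \<longlongrightarrow> v n) \<F>" and S: "(S \<longlongrightarrow> T) \<F>"
  shows "lq_bounded q v T"
proof -
  have T: "0 \<le> T"
    by (rule tendsto_lowerbound[OF S _ \<F>]) (use b in \<open>auto elim: eventually_mono simp: lq_bounded_def\<close>)
  show ?thesis
  proof (cases "q = \<infinity>")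
    case True
    have "\<bar>v n\<bar> \<le> T" for n
      by (rule tendsto_le[OF \<F> S tendsto_rabs[OF u]])
        (use b True in \<open>auto elim: eventually_mono simp: lq_bounded_def\<close>)
    then show ?thesis using True T by (simp add: lq_bounded_def)
  next
    case False
    note r = enn2real_ge_1[OF q False]
    have *: "(\<Sum>n\<in>F. \<bar>v n\<bar> powr enn2real q) \<le> T powr enn2real q" if "finite F" for F
    proof (rule tendsto_le[OF \<F>])
      show "((\<lambda>x. S x powr enn2real q) \<longlongrightarrow> T powr enn2real q) \<F>"
        using b r by (intro tendsto_powr2 S tendsto_const) (auto elim: eventually_mono simp: lq_bounded_def)
      show "((\<lambda>x. \<Sum>n\<in>F. \<bar>u x n\<bar> powr enn2real q) \<longlongrightarrow> (\<Sum>n\<in>F. \<bar>v n\<bar> powr enn2real q)) \<F>"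
        using r by (intro tendsto_sum tendsto_powr2 tendsto_rabs u tendsto_const) auto
    qed (use b False that in \<open>auto elim: eventually_mono simp: lq_bounded_def\<close>)
    then show ?thesis using False T by (simp add: lq_bounded_def)
  qed
qed

text \<open>Minkowski's inequality for series: it holds for finite sums and survives the limit over
  finite index sets. The pointwise bound of \<open>u i n\<close> by \<open>S i\<close> supplies
  convergence at each \<open>n\<close>.\<close>

lemma lq_bounded_infsum:
  fixes u :: "'k \<Rightarrow> 'i \<Rightarrow> real"
  assumes "1 \<le> q" "\<And>i. lq_bounded q (u i) (S i)" "S summable_on UNIV"
  shows "lq_bounded q (\<lambda>n. \<Sum>\<^sub>\<infinity>i. u i n) (\<Sum>\<^sub>\<infinity>i. S i)"
proof (rule lq_bounded_limit[OF assms(1)])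
  show "finite_subsets_at_top (UNIV::'k set) \<noteq> bot"
    by simp
  show "\<forall>\<^sub>F I in finite_subsets_at_top UNIV. lq_bounded q (\<lambda>n. \<Sum>i\<in>I. u i n) (\<Sum>i\<in>I. S i)"
    by (rule eventually_finite_subsets_at_top_weakI) (auto intro: lq_bounded_sum assms)
  show "((\<lambda>I. \<Sum>i\<in>I. S i) \<longlongrightarrow> (\<Sum>\<^sub>\<infinity>i. S i)) (finite_subsets_at_top UNIV)"
    by (rule infsum_tendsto[OF assms(3)])
  fix n
  have "(\<lambda>i. u i n) summable_on UNIV"
    using lq_bounded_point[OF assms(2,1), of _ n]
    by (intro summable_on_dominated[OF assms(3)]) simp
  then show "((\<lambda>I. \<Sum>i\<in>I. u i n) \<longlongrightarrow> (\<Sum>\<^sub>\<infinity>i. u i n)) (finite_subsets_at_top UNIV)"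
    by (rule infsum_tendsto)
qed

lemma lq_bounded_reindex:
  assumes "lq_bounded q u S" "inj \<pi>"
  shows "lq_bounded q (\<lambda>n. u (\<pi> n)) S"
proof (cases "q = \<infinity>")
  case True
  then show ?thesis using assms by (simp add: lq_bounded_def)
next
  case False
  have "(\<Sum>n\<in>F. \<bar>u (\<pi> n)\<bar> powr enn2real q) \<le> S powr enn2real q" if "finite F" for F
  proof -
    have "(\<Sum>n\<in>F. \<bar>u (\<pi> n)\<bar> powr enn2real q) = (\<Sum>n\<in>\<pi> ` F. \<bar>u n\<bar> powr enn2real q)"
      using assms(2) by (subst sum.reindex) (auto intro: inj_on_subset)
    also have "\<dots> \<le> S powr enn2real q"
      using assms that False by (auto simp: lq_bounded_def)
    finally show ?thesis .
  qed
  then show ?thesis using assms False by (auto simp: lq_bounded_def)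
qed

lemma lq_bounded_single:
  "lq_bounded q (\<lambda>n. if n = i then c else 0) \<bar>c\<bar>"
proof -
  have "(\<Sum>n\<in>F. \<bar>if n = i then c else 0\<bar> powr r) \<le> \<bar>c\<bar> powr r" if "finite F" for F and r :: real
  proof -
    have "(\<Sum>n\<in>F. \<bar>if n = i then c else 0\<bar> powr r) = (\<Sum>n\<in>F. if n = i then \<bar>c\<bar> powr r else 0)"
      by (intro sum.cong) auto
    then show ?thesis using that by simp
  qed
  then show ?thesis by (auto simp: lq_bounded_def)
qed

text \<open>A nonnegative summable sequence is a superposition of point masses, and the point mass
  at \<open>i\<close> has norm \<open>u i\<close> for every exponent.\<close>

lemma lq_bounded_l1:
  fixes u :: "'i \<Rightarrow> real"
  assumes "1 \<le> q" "u summable_on UNIV" "\<And>i. 0 \<le> u i"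
  shows "lq_bounded q u (\<Sum>\<^sub>\<infinity>i. u i)"
proof -
  have "lq_bounded q (\<lambda>n. \<Sum>\<^sub>\<infinity>i. if n = i then u i else 0) (\<Sum>\<^sub>\<infinity>i. u i)"
    by (rule lq_bounded_infsum[OF assms(1) _ assms(2)])
      (metis lq_bounded_single assms(3) abs_of_nonneg)
  moreover have "(\<Sum>\<^sub>\<infinity>i. if n = i then u i else 0) = u n" for n
    using infsum_cong_neutral[where S = UNIV and T = "{n}" and f = "\<lambda>i. if n = i then u i else 0" and g = u]
    by auto
  ultimately show ?thesis by simp
qed

text \<open>Iterating the step improves the bound \<open>S\<close> to
  \<open>2 * K + S / 2 ^ n\<close>, so the initial bound disappears in the limit. A finite initial
  bound, however large, is what starts the iteration.\<close>

lemma lq_bounded_absorb: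
  assumes q: "1 \<le> q" and S: "lq_bounded q u S" and K: "0 \<le> K"
    and step: "\<And>S. lq_bounded q u S \<Longrightarrow> lq_bounded q u (K + S / 2)"
  shows "lq_bounded q u (2 * K)"
proof (rule lq_bounded_limit[OF q sequentially_bot, where u = "\<lambda>_. u"])
  have "lq_bounded q u (2 * K + S / 2 ^ n)" for n
  proof (induction n)
    case 0
    show ?case by (rule lq_bounded_mono[OF S q]) (use K in auto)
  next
    case (Suc n)
    from step[OF this] show ?case by (simp add: field_simps)
  qed
  then show "\<forall>\<^sub>F n in sequentially. lq_bounded q u (2 * K + S / 2 ^ n)"
    by simp
  have "(\<lambda>n. 2 * K + S * (1/2) ^ n) \<longlonglongrightarrow> 2 * K + S * 0"
    by (intro tendsto_intros LIMSEQ_power_zero) auto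
  then show "(\<lambda>n. 2 * K + S / 2 ^ n) \<longlonglongrightarrow> 2 * K"
    by (simp add: power_divide)
qed auto

text \<open>Young's inequality with a summable kernel: the convolution is a superposition of
  translates of \<open>u\<close> with weights \<open>w i\<close>, and translation preserves the
  norm.\<close>

lemma lq_bounded_convolution:
  fixes u w :: "'i::ab_group_add \<Rightarrow> real"
  assumes q: "1 \<le> q" and u: "lq_bounded q u S" and w: "\<And>i. 0 \<le> w i" "w summable_on UNIV"
  shows "lq_bounded q (\<lambda>k. \<Sum>\<^sub>\<infinity>j. u j * w (k - j)) ((\<Sum>\<^sub>\<infinity>i. w i) * S)"
proof -
  have "lq_bounded q (\<lambda>k. \<Sum>\<^sub>\<infinity>i. w i * u (k - i)) (\<Sum>\<^sub>\<infinity>i. w i * S)"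
    by (intro lq_bounded_infsum lq_bounded_cmult lq_bounded_reindex[OF u] q w summable_on_cmult_left)
      (auto intro: injI)
  moreover have "(\<Sum>\<^sub>\<infinity>i. w i * u (k - i)) = (\<Sum>\<^sub>\<infinity>j. u j * w (k - j))" for k
  proof -
    have "bij_betw (\<lambda>j. k - j) UNIV UNIV"
      by (rule bij_betwI[where g = "\<lambda>j. k - j"]) auto
    from infsum_reindex_bij_betw[OF this, of "\<lambda>i. w i * u (k - i)"] show ?thesis
      by (simp add: mult.commute)
  qed
  ultimately show ?thesis
    using infsum_cmult_left[of S w UNIV] w by simp
qed

text \<open>The infimum is meaningful only for sequences that have some finite bound, since
  otherwise it is taken over the empty set.\<close>

definition lq_norm :: "ennreal \<Rightarrow> ('i \<Rightarrow> real) \<Rightarrow> real" where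
  "lq_norm q u = Inf {S. lq_bounded q u S}"

lemma lq_norm_le: "lq_bounded q u S \<Longrightarrow> lq_norm q u \<le> S"
  unfolding lq_norm_def by (intro cInf_lower bdd_belowI[of _ 0]) (auto dest: lq_bounded_nonneg)

text \<open>Admissible bounds are upward closed, so every number to the right of the infimum is
  admissible; letting these numbers decrease to the infimum keeps the bound.\<close>

lemma lq_bounded_lq_norm:
  assumes "1 \<le> q" "lq_bounded q u S"
  shows "lq_bounded q u (lq_norm q u)"
proof (rule lq_bounded_limit[OF assms(1), where \<F> = "at_right (lq_norm q u)" and u = "\<lambda>_. u" and S = "\<lambda>x. x"])
  show "\<forall>\<^sub>F x in at_right (lq_norm q u). lq_bounded q u x"
    unfolding eventually_at_filter
  proof (intro always_eventually allI impI)
    fix x assume "x \<noteq> lq_norm q u" "x \<in> {lq_norm q u<..}"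
    then obtain T where "lq_bounded q u T" "T < x"
      using cInf_lessD[of "{S. lq_bounded q u S}" x] assms(2) by (auto simp: lq_norm_def)
    then show "lq_bounded q u x"
      using lq_bounded_mono[OF _ assms(1)] by fastforce
  qed
qed (auto intro: tendsto_ident_at)

lemma infsum_shift:
  fixes f :: "'i::ab_group_add \<Rightarrow> real"
  shows "(\<Sum>\<^sub>\<infinity>k. f (k - n)) = (\<Sum>\<^sub>\<infinity>k. f k)" and "(\<Sum>\<^sub>\<infinity>k. f (n - k)) = (\<Sum>\<^sub>\<infinity>k. f k)"
    and "(\<lambda>k. f (k - n)) summable_on UNIV \<longleftrightarrow> f summable_on UNIV"
    and "(\<lambda>k. f (n - k)) summable_on UNIV \<longleftrightarrow> f summable_on UNIV"
proof -
  have 1: "bij_betw (\<lambda>k. k - n) UNIV UNIV"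
    by (rule bij_betwI[where g = "\<lambda>k. k + n"]) auto
  have 2: "bij_betw (\<lambda>k. n - k) UNIV UNIV"
    by (rule bij_betwI[where g = "\<lambda>k. n - k"]) auto
  show "(\<Sum>\<^sub>\<infinity>k. f (k - n)) = (\<Sum>\<^sub>\<infinity>k. f k)" "(\<Sum>\<^sub>\<infinity>k. f (n - k)) = (\<Sum>\<^sub>\<infinity>k. f k)"
    using infsum_reindex_bij_betw[OF 1, of f] infsum_reindex_bij_betw[OF 2, of f] by auto
  show "(\<lambda>k. f (k - n)) summable_on UNIV \<longleftrightarrow> f summable_on UNIV"
    "(\<lambda>k. f (n - k)) summable_on UNIV \<longleftrightarrow> f summable_on UNIV"
    using summable_on_reindex_bij_betw[OF 1, of f] summable_on_reindex_bij_betw[OF 2, of f] by auto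
qed

lemma summable_on_mult_bounded:
  fixes f g :: "'a \<Rightarrow> real"
  assumes "f summable_on A" "\<And>x. x \<in> A \<Longrightarrow> 0 \<le> f x" "\<And>x. x \<in> A \<Longrightarrow> \<bar>g x\<bar> \<le> B"
  shows "(\<lambda>x. f x * g x) summable_on A"
proof (rule summable_on_dominated)
  show "(\<lambda>x. f x * B) summable_on A"
    by (rule summable_on_cmult_left[OF assms(1)])
  show "norm (f x * g x) \<le> f x * B" if "x \<in> A" for x
    using assms(2,3)[OF that] by (simp add: abs_mult mult_left_mono)
qed

section \<open>Localization by slowly varying windows\<close>

lemma lq_bounded_localization:
  fixes \<psi> t W u h :: "'i::ab_group_add \<Rightarrow> real"
  assumes p: "1 \<le> p" and q: "1 \<le> q"
    and \<psi>: "\<And>i. 0 \<le> \<psi> i" "\<psi> summable_on UNIV" "\<psi> 0 = 1"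
    and slow: "\<And>i j. \<bar>\<psi> (j + i) - \<psi> j\<bar> \<le> t i * (\<psi> j + \<psi> (j + i))"
    and t: "\<And>i. 0 \<le> t i" and W: "\<And>i. 0 \<le> W i" "(\<lambda>i. W i * t i) summable_on UNIV"
    and C: "0 \<le> C" and small: "4 * C * (\<Sum>\<^sub>\<infinity>i. W i * t i) \<le> 1"
    and u: "\<And>i. 0 \<le> u i" "lq_bounded q u S\<^sub>0" and h: "\<And>i. 0 \<le> h i" "lq_bounded q h F"
    and stable: "\<And>n S. lq_bounded p
        (\<lambda>k. \<psi> (k - n) * h k + (\<Sum>\<^sub>\<infinity>j. W (k - j) * \<bar>\<psi> (j - n) - \<psi> (k - n)\<bar> * u j)) S
      \<Longrightarrow> lq_bounded p (\<lambda>k. \<psi> (k - n) * u k) (C * S)"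
  shows "lq_bounded q u (2 * (C * (\<Sum>\<^sub>\<infinity>i. \<psi> i) * F))"
proof -
  define \<Psi> \<epsilon> where "\<Psi> = (\<Sum>\<^sub>\<infinity>i. \<psi> i)" and "\<epsilon> = (\<Sum>\<^sub>\<infinity>i. W i * t i)"
  have \<Psi>: "0 \<le> \<Psi>" unfolding \<Psi>_def using \<psi> by (intro infsum_nonneg) auto
  define a where "a n = lq_norm p (\<lambda>k. \<psi> (k - n) * u k)" for n
  define B where "B n = (\<Sum>\<^sub>\<infinity>k. h k * \<psi> (k - n))" for n
  define A where "A n = (\<Sum>\<^sub>\<infinity>k. u k * \<psi> (k - n))" for n
  \<comment> \<open>The l^p norm of a windowed sequence is at most its l^1 norm, which as a function
    of the window position is a convolution and hence under control in l^q.\<close>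
  have weighted: "lq_bounded p (\<lambda>k. \<psi> (k - n) * v k) (\<Sum>\<^sub>\<infinity>k. v k * \<psi> (k - n))"
    if v: "\<And>i. 0 \<le> v i" "lq_bounded q v S" for v S n
  proof -
    have "(\<lambda>k. \<psi> (k - n) * v k) summable_on UNIV"
      by (rule summable_on_mult_bounded[where B = S])
        (use \<psi> v lq_bounded_point[OF v(2) q] infsum_shift(3)[of \<psi> n] in auto)
    from lq_bounded_l1[OF p this] show ?thesis
      using \<psi> v by (simp add: mult.commute)
  qed
  have weighted_sum: "lq_bounded q (\<lambda>n. \<Sum>\<^sub>\<infinity>k. v k * \<psi> (k - n)) (\<Psi> * S)"
    if v: "lq_bounded q v S" for v S
    using lq_bounded_convolution[OF q v, of "\<lambda>i. \<psi> (- i)"] \<psi> infsum_shift[of \<psi> 0]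
    by (simp add: \<Psi>_def)
  have a: "lq_bounded p (\<lambda>k. \<psi> (k - n) * u k) (a n)" for n
    unfolding a_def by (rule lq_bounded_lq_norm[OF p weighted[OF u]])
  note a_nonneg = lq_bounded_nonneg[OF a]
  have a_le: "a n \<le> A n" for n
    unfolding a_def A_def by (rule lq_norm_le[OF weighted[OF u]])
  have bA: "lq_bounded q A (\<Psi> * S\<^sub>0)"
    using weighted_sum[OF u(2)] by (simp add: A_def[abs_def])
  \<comment> \<open>A priori bound that starts the absorption below; its size depends on
    \<open>S\<^sub>0\<close>, the final bound does not.\<close>
  have ba: "lq_bounded q a (\<Psi> * S\<^sub>0)"
    by (rule lq_bounded_mono[OF bA q]) (use a_le a_nonneg in \<open>auto intro: order_trans[OF _ abs_ge_self]\<close>)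
  have a_bound: "\<bar>a n\<bar> \<le> \<Psi> * S\<^sub>0" for n
    by (rule lq_bounded_point[OF ba q])
  have bB: "lq_bounded q B (\<Psi> * F)"
    using weighted_sum[OF h(2)] by (simp add: B_def[abs_def])
  define R where "R n = (\<Sum>\<^sub>\<infinity>i. W i * t i * (a n + a (n - i)))" for n
  have sR: "(\<lambda>i. W i * t i * (a n + a (n - i))) summable_on UNIV" for n
  proof (rule summable_on_mult_bounded[OF W(2)])
    show "\<bar>a n + a (n - i)\<bar> \<le> 2 * (\<Psi> * S\<^sub>0)" for i
      using a_bound[of n] a_bound[of "n - i"] by linarith
  qed (use W t in auto)
  \<comment> \<open>With j = k - i, the window centred at \<open>n\<close> takes at \<open>k\<close>
    the value that the window centred at \<open>n - i\<close> takes at \<open>k - i\<close>. Slow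
    variation thus bounds the i-th term by a translate of two windowed copies of \<open>u\<close>,
    with norms \<open>a n\<close> and \<open>a (n - i)\<close>.\<close>
  have commutator: "lq_bounded p (\<lambda>k. \<Sum>\<^sub>\<infinity>j. W (k - j) * \<bar>\<psi> (j - n) - \<psi> (k - n)\<bar> * u j) (R n)" for n
  proof -
    have "lq_bounded p (\<lambda>k. \<Sum>\<^sub>\<infinity>i. W i * \<bar>\<psi> (k - i - n) - \<psi> (k - n)\<bar> * u (k - i)) (R n)"
      unfolding R_def
    proof (rule lq_bounded_infsum[OF p _ sR])
      fix i
      have inj: "inj (\<lambda>k::'i. k - i)"
        by (auto intro: injI)
      have "lq_bounded p (\<lambda>k. W i * t i * (\<psi> (k - i - n) * u (k - i) + \<psi> (k - i - (n - i)) * u (k - i)))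
          (W i * t i * (a n + a (n - i)))"
        by (intro lq_bounded_cmult lq_bounded_add p
              lq_bounded_reindex[OF a[of n] inj] lq_bounded_reindex[OF a[of "n - i"] inj])
          (use W t in auto)
      then show "lq_bounded p (\<lambda>k. W i * \<bar>\<psi> (k - i - n) - \<psi> (k - n)\<bar> * u (k - i))
          (W i * t i * (a n + a (n - i)))"
      proof (rule lq_bounded_mono[OF _ p])
        fix k
        have "\<bar>\<psi> (k - i - n) - \<psi> (k - n)\<bar> \<le> t i * (\<psi> (k - i - n) + \<psi> (k - n))"
          using slow[of "k - i - n" i] by (simp add: algebra_simps abs_minus_commute)
        then have "W i * \<bar>\<psi> (k - i - n) - \<psi> (k - n)\<bar> * u (k - i)
            \<le> W i * (t i * (\<psi> (k - i - n) + \<psi> (k - n))) * u (k - i)"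
          using W u by (intro mult_right_mono mult_left_mono) auto
        also have "\<dots> = W i * t i * (\<psi> (k - i - n) * u (k - i) + \<psi> (k - i - (n - i)) * u (k - i))"
          by (simp add: algebra_simps)
        finally show "\<bar>W i * \<bar>\<psi> (k - i - n) - \<psi> (k - n)\<bar> * u (k - i)\<bar>
            \<le> \<bar>W i * t i * (\<psi> (k - i - n) * u (k - i) + \<psi> (k - i - (n - i)) * u (k - i))\<bar>"
          using W u by simp
      qed simp
    qed
    moreover have "(\<Sum>\<^sub>\<infinity>i. W i * \<bar>\<psi> (k - i - n) - \<psi> (k - n)\<bar> * u (k - i))
        = (\<Sum>\<^sub>\<infinity>j. W (k - j) * \<bar>\<psi> (j - n) - \<psi> (k - n)\<bar> * u j)" for k
      using infsum_shift(2)[of "\<lambda>i. W i * \<bar>\<psi> (k - i - n) - \<psi> (k - n)\<bar> * u (k - i)" k] by simp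
    ultimately show ?thesis by simp
  qed
  have a_step: "a n \<le> C * (B n + R n)" for n
    unfolding a_def
    by (rule lq_norm_le, rule stable, rule lq_bounded_add[OF _ commutator p])
      (use weighted[OF h] in \<open>simp add: B_def\<close>)
  have "lq_bounded q a (2 * (C * \<Psi> * F))"
  proof (rule lq_bounded_absorb[OF q ba])
    show "0 \<le> C * \<Psi> * F"
      using C \<Psi> lq_bounded_nonneg[OF h(2)] by simp
    fix S assume S: "lq_bounded q a S"
    have "lq_bounded q (\<lambda>n. \<Sum>\<^sub>\<infinity>i. W i * t i * (a n + a (n - i))) (\<Sum>\<^sub>\<infinity>i. W i * t i * (S + S))"
      by (intro lq_bounded_infsum lq_bounded_cmult lq_bounded_add lq_bounded_reindex[OF S] S q
            summable_on_cmult_left W)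
        (use W t in \<open>auto intro: injI\<close>)
    then have "lq_bounded q R (\<epsilon> * (S + S))"
      using infsum_cmult_left[OF W(2), of "S + S"] by (simp add: R_def[abs_def] \<epsilon>_def)
    then have "lq_bounded q (\<lambda>n. C * (B n + R n)) (C * (\<Psi> * F + \<epsilon> * (S + S)))"
      by (intro lq_bounded_cmult lq_bounded_add bB q C)
    then show "lq_bounded q a (C * \<Psi> * F + S / 2)"
    proof (rule lq_bounded_mono[OF _ q])
      show "\<bar>a n\<bar> \<le> \<bar>C * (B n + R n)\<bar>" for n
        using a_step[of n] a_nonneg[of n] by linarith
      \<comment> \<open>The two occurrences of \<open>a\<close> in \<open>R\<close> contribute
        \<open>2 * C * \<epsilon> * S\<close>, which the factor 4 in the smallness hypothesis
        reduces to at most \<open>S / 2\<close>.\<close>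
      have "4 * C * \<epsilon> * (S / 2) \<le> 1 * (S / 2)"
        using small lq_bounded_nonneg[OF S] by (intro mult_right_mono) (auto simp: \<epsilon>_def)
      then show "C * (\<Psi> * F + \<epsilon> * (S + S)) \<le> C * \<Psi> * F + S / 2"
        by (simp add: algebra_simps)
    qed
  qed
  then show ?thesis
    unfolding \<Psi>_def[symmetric]
  proof (rule lq_bounded_mono[OF _ q])
    \<comment> \<open>From the windowed norm only the entry at the centre \<open>k = n\<close> is
      kept, where the window equals 1.\<close>
    show "\<bar>u n\<bar> \<le> \<bar>a n\<bar>" for n
      using lq_bounded_point[OF a p, of n n] \<psi>(3) by (simp add: a_nonneg)
  qed simp
qed

section \<open>Exponential windows on the integer lattice\<close>

lemma summable_on_vec_prod:
  fixes f :: "'a::countable \<Rightarrow> real"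
  assumes "f summable_on UNIV" "\<And>x. 0 \<le> f x"
  shows "(\<lambda>k :: 'a ^ 'd. \<Prod>i\<in>UNIV. f (k $ i)) summable_on UNIV"
proof -
  have "(\<lambda>x. norm (f x)) summable_on UNIV"
    using assms(1) summable_on_iff_abs_summable_on_real by blast
  then have "Infinite_Set_Sum.abs_summable_on f UNIV"
    by (rule abs_summable_equivalent[THEN iffD1])
  then have "Infinite_Set_Sum.abs_summable_on (\<lambda>g::'d \<Rightarrow> 'a. \<Prod>i\<in>UNIV. f (g i)) (PiE UNIV (\<lambda>_. UNIV))"
    by (intro abs_summable_on_prod_PiE) auto
  then have "(\<lambda>g::'d \<Rightarrow> 'a. norm (\<Prod>i\<in>UNIV. f (g i))) summable_on UNIV"
    unfolding abs_summable_equivalent[symmetric] by (simp add: PiE_UNIV_domain)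
  then have "(\<lambda>g::'d \<Rightarrow> 'a. \<Prod>i\<in>UNIV. f (g i)) summable_on UNIV"
    by (rule abs_summable_summable)
  moreover have "bij_betw (\<lambda>k :: 'a ^ 'd. ($) k) UNIV UNIV"
    by (rule bij_betwI[where g = vec_lambda]) auto
  ultimately show ?thesis
    using summable_on_reindex_bij_betw[of "\<lambda>k :: 'a ^ 'd. ($) k" UNIV UNIV "\<lambda>g. \<Prod>i\<in>UNIV. f (g i)"]
    by simp
qed

lemma summable_on_exp_int:
  fixes N :: real
  assumes "0 < N"
  shows "(\<lambda>k::int. exp (- \<bar>of_int k\<bar> / N)) summable_on UNIV"
proof -
  have "summable (\<lambda>n. exp (- (1 / N)) ^ n)"
    using assms by (intro summable_geometric) simp
  then have "summable (\<lambda>n. exp (- \<bar>of_int (int n)\<bar> / N))"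
    by (simp add: exp_of_nat_mult[symmetric])
  then have *: "(\<lambda>n. exp (- \<bar>of_int (int n)\<bar> / N)) summable_on UNIV"
    by (intro norm_summable_imp_summable_on) simp
  then have 1: "(\<lambda>k::int. exp (- \<bar>of_int k\<bar> / N)) summable_on (range int)"
    by (subst summable_on_reindex) (auto simp: o_def)
  have 2: "(\<lambda>k::int. exp (- \<bar>of_int k\<bar> / N)) summable_on (range (\<lambda>n. - int n))"
    using * by (subst summable_on_reindex) (auto simp: o_def inj_def)
  have U: "UNIV = range int \<union> (range (\<lambda>n. - int n) - range int)"
  proof -
    have "k \<in> range int \<union> range (\<lambda>n. - int n)" for k
      by (cases k rule: int_cases2) auto
    then show ?thesis by blast
  qed
  show ?thesis
    by (subst U, rule summable_on_Un_disjoint[OF 1 summable_on_subset_banach[OF 2]]) auto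
qed

text \<open>With this choice of norm the exponential window factors over the coordinates, so its
  summability reduces to dimension one.\<close>

definition l1_norm :: "int ^ 'd \<Rightarrow> real" where
  "l1_norm k = (\<Sum>i\<in>UNIV. \<bar>of_int (k $ i)\<bar>)"

definition exp_window :: "real \<Rightarrow> int ^ 'd \<Rightarrow> real" where
  "exp_window N k = exp (- l1_norm k / N)"

lemma l1_norm_nonneg: "0 \<le> l1_norm k"
  by (simp add: l1_norm_def sum_nonneg)

lemma summable_exp_window:
  assumes "0 < N"
  shows "exp_window N summable_on (UNIV :: (int ^ 'd) set)"
proof -
  have "exp_window N = (\<lambda>k :: int ^ 'd. \<Prod>i\<in>UNIV. exp (- \<bar>of_int (k $ i)\<bar> / N))"
    by (simp add: fun_eq_iff exp_window_def l1_norm_def exp_sum[symmetric] sum_divide_distrib sum_negf)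
  then show ?thesis
    using summable_on_vec_prod[OF summable_on_exp_int[OF assms], where 'd = 'd] by simp
qed

text \<open>The linear bound comes from \<open>1 + s \<le> exp s\<close>, which gives
  \<open>exp (- x) - exp (- y) \<le> (y - x) * exp (- x)\<close>, and from the triangle inequality
  for \<open>l1_norm\<close>. The bound by 1 is trivial and is kept because it makes
  \<open>W i * t i\<close> summable without any moment condition on \<open>W\<close>.\<close>

lemma exp_window_slow:
  assumes "0 < N"
  shows "\<bar>exp_window N (j + i) - exp_window N j\<bar>
    \<le> min 1 (l1_norm i / N) * (exp_window N j + exp_window N (j + i))"
proof -
  define x y where "x = l1_norm (j + i) / N" and "y = l1_norm j / N"
  have le: "\<bar>l1_norm (j + i) - l1_norm j\<bar> \<le> l1_norm i"
  proof -
    have "\<bar>l1_norm (j + i) - l1_norm j\<bar>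
        = \<bar>\<Sum>m\<in>UNIV. \<bar>of_int ((j + i) $ m)\<bar> - \<bar>of_int (j $ m) :: real\<bar>\<bar>"
      by (simp add: l1_norm_def sum_subtractf)
    also have "\<dots> \<le> (\<Sum>m\<in>UNIV. \<bar>of_int (i $ m)\<bar>)"
      by (rule order_trans[OF sum_abs sum_mono]) auto
    finally show ?thesis by (simp add: l1_norm_def)
  qed
  have xy: "\<bar>x - y\<bar> \<le> l1_norm i / N"
    using le assms by (simp add: x_def y_def diff_divide_distrib[symmetric] divide_right_mono)
  have exp_diff: "\<bar>exp (- x) - exp (- y)\<bar> \<le> \<bar>x - y\<bar> * (exp (- y) + exp (- x))" for x y :: real
  proof -
    have *: "exp (- x) - exp (- y) \<le> (y - x) * exp (- x)" for x y :: real
    proof -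
      have "exp (- x) * (1 + (x - y)) \<le> exp (- x) * exp (x - y)"
        by (intro mult_left_mono exp_ge_add_one_self) auto
      then show ?thesis by (simp add: exp_add[symmetric] algebra_simps)
    qed
    have "0 \<le> \<bar>x - y\<bar> * exp (- x)" "0 \<le> \<bar>x - y\<bar> * exp (- y)"
      by auto
    moreover have "(y - x) * exp (- x) \<le> \<bar>x - y\<bar> * exp (- x)" "(x - y) * exp (- y) \<le> \<bar>x - y\<bar> * exp (- y)"
      by (auto intro: mult_right_mono simp del: mult_le_cancel_right)
    ultimately show ?thesis
      unfolding distrib_left abs_le_iff using *[of x y] *[of y x] by linarith
  qed
  have "\<bar>exp (- x) - exp (- y)\<bar> \<le> min 1 (l1_norm i / N) * (exp (- y) + exp (- x))"
  proof (cases "1 \<le> l1_norm i / N")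
    case True
    have "\<bar>exp (- x) - exp (- y)\<bar> \<le> exp (- y) + exp (- x)"
      using exp_gt_zero[of "- x"] exp_gt_zero[of "- y"] by linarith
    then show ?thesis using True by simp
  next
    case False
    have "\<bar>exp (- x) - exp (- y)\<bar> \<le> l1_norm i / N * (exp (- y) + exp (- x))"
      by (rule order_trans[OF exp_diff mult_right_mono[OF xy]]) (simp add: add_nonneg_nonneg)
    then show ?thesis using False by simp
  qed
  then show ?thesis by (simp add: exp_window_def x_def y_def)
qed

text \<open>Dominated convergence as the scale grows: a finite set \<open>I\<close> carries all but
  \<epsilon>/2 of the mass of \<open>W\<close>. On \<open>I\<close> the factor
  \<open>l1_norm i / N\<close> is made small by \<open>N\<close>, and off \<open>I\<close> the
  factor is at most 1.\<close>

lemma window_scale_exists: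
  fixes W :: "int ^ 'd \<Rightarrow> real"
  assumes W: "\<And>i. 0 \<le> W i" "W summable_on UNIV" and "0 < \<epsilon>"
  obtains N where "0 < N" "(\<Sum>\<^sub>\<infinity>i. W i * min 1 (l1_norm i / N)) \<le> \<epsilon>"
proof -
  obtain I where I: "finite I" "dist (sum W I) (infsum W UNIV) \<le> \<epsilon> / 2"
    using infsum_finite_approximation[OF W(2), of "\<epsilon> / 2"] \<open>0 < \<epsilon>\<close> by auto
  define M where "M = (\<Sum>i\<in>I. W i * l1_norm i)"
  have M: "0 \<le> M" unfolding M_def using W l1_norm_nonneg by (intro sum_nonneg mult_nonneg_nonneg) auto
  \<comment> \<open>Chosen to give \<open>M / N \<le> \<epsilon> / 2\<close>; the summand 1 keeps
    \<open>N\<close> positive when \<open>M\<close> is zero.\<close>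
  define N where "N = 2 * (M + 1) / \<epsilon>"
  have N: "0 < N" using M \<open>0 < \<epsilon>\<close> by (simp add: N_def)
  have t: "0 \<le> l1_norm i / N" for i :: "int ^ 'd"
    by (intro divide_nonneg_pos l1_norm_nonneg N)
  have s: "(\<lambda>i. W i * min 1 (l1_norm i / N)) summable_on UNIV"
    by (rule summable_on_mult_bounded[OF W(2), where B = 1]) (use W t in auto)
  have "(\<Sum>\<^sub>\<infinity>i. W i * min 1 (l1_norm i / N))
      = (\<Sum>i\<in>I. W i * min 1 (l1_norm i / N)) + (\<Sum>\<^sub>\<infinity>i\<in>UNIV - I. W i * min 1 (l1_norm i / N))"
    using infsum_Diff[OF s, of I] I(1) by simp
  also have "(\<Sum>i\<in>I. W i * min 1 (l1_norm i / N)) \<le> (\<Sum>i\<in>I. W i * (l1_norm i / N))"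
    using W by (intro sum_mono mult_left_mono) auto
  also have "\<dots> = M / N"
    by (simp add: M_def sum_divide_distrib)
  also have "\<dots> \<le> \<epsilon> / 2"
    using M \<open>0 < \<epsilon>\<close> by (simp add: N_def field_simps)
  also have "(\<Sum>\<^sub>\<infinity>i\<in>UNIV - I. W i * min 1 (l1_norm i / N)) \<le> (\<Sum>\<^sub>\<infinity>i\<in>UNIV - I. W i)"
    using W I(1) s by (intro infsum_mono summable_on_cofin_subset) (auto intro: mult_left_le)
  also have "(\<Sum>\<^sub>\<infinity>i\<in>UNIV - I. W i) = infsum W UNIV - sum W I"
    using infsum_Diff[OF W(2), of I] I(1) by simp
  also have "\<dots> \<le> \<epsilon> / 2"
    using I(2) unfolding dist_real_def by linarith
  finally have "(\<Sum>\<^sub>\<infinity>i. W i * min 1 (l1_norm i / N)) \<le> \<epsilon>"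
    by simp
  with N show ?thesis by (rule that)
qed

section \<open>Comparison with the norms of Lebesgue spaces\<close>

text \<open>The function is dominated by one that is constant on the cells of \<open>ind\<close>,
  each of measure at most \<open>R\<close>. As \<open>R\<close> is at least 1, its power
  \<open>R powr (1 / r)\<close> is at most \<open>R\<close>, so one constant serves all exponents.
  The lemma is used for Lebesgue measure with unit cells and for counting measure on
  \<Lambda>.\<close>

lemma Lp_norm_le_lq_bounded:
  fixes ind :: "'a \<Rightarrow> 'i::countable" and u :: "'i \<Rightarrow> real"
  assumes q: "1 \<le> q" and f[measurable]: "f \<in> borel_measurable M"
    and ind[measurable]: "ind \<in> measurable M (count_space UNIV)"
    and R: "1 \<le> R" "\<And>k. emeasure M (ind -` {k} \<inter> space M) \<le> ennreal R"
    and fu: "\<And>x. x \<in> space M \<Longrightarrow> norm (f x) \<le> u (ind x)"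
    and u: "\<And>k. 0 \<le> u k" "lq_bounded q u S"
  shows "Lp_norm M q f \<le> ennreal (R * S)"
proof (cases "q = \<infinity>")
  case True
  have S: "0 \<le> S" by (rule lq_bounded_nonneg[OF u(2)])
  have "ennreal (norm (f x)) \<le> ennreal (R * S)" if "x \<in> space M" for x
  proof (rule ennreal_leI)
    have "norm (f x) \<le> S"
      using fu[OF that] lq_bounded_point[OF u(2) q, of "ind x"] by linarith
    also have "\<dots> \<le> R * S"
      using mult_right_mono[OF R(1) S] by simp
    finally show "norm (f x) \<le> R * S" .
  qed
  then show ?thesis using True by (auto simp: Lp_norm_def intro!: esssup_I)
next
  case False
  define r where "r = enn2real q"
  have r: "1 \<le> r" unfolding r_def by (rule enn2real_ge_1[OF q False])
  have S: "0 \<le> S" by (rule lq_bounded_nonneg[OF u(2)])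
  define I where "I = (\<integral>\<^sup>+x. ennreal (norm (f x) powr r) \<partial>M)"
  \<comment> \<open>Finite sets exhausting the countable index set: \<open>lq_bounded\<close>
    controls finite sums only, and monotone convergence does the rest.\<close>
  define A where "A n = {k::'i. to_nat k < n}" for n
  have A: "finite (A n)" for n
    unfolding A_def using finite_vimageI[OF finite_lessThan inj_to_nat, of n] by (simp add: vimage_def)
  define g where "g n x = (\<Sum>k\<in>A n. ennreal (u k powr r) * indicator (ind -` {k} \<inter> space M) x)" for n x
  have g: "g n x = (if ind x \<in> A n then ennreal (u (ind x) powr r) else 0)" if "x \<in> space M" for n x
  proof -
    have "g n x = (\<Sum>k\<in>A n. if k = ind x then ennreal (u k powr r) else 0)"
      unfolding g_def using that by (intro sum.cong) (auto simp: indicator_def)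
    then show ?thesis using A by simp
  qed
  have "I \<le> (\<integral>\<^sup>+x. (SUP n. g n x) \<partial>M)"
    unfolding I_def
  proof (rule nn_integral_mono)
    fix x assume x: "x \<in> space M"
    have "ennreal (norm (f x) powr r) \<le> g (Suc (to_nat (ind x))) x"
      using r fu[OF x] by (auto simp: g[OF x] A_def intro!: ennreal_leI powr_mono2)
    also have "\<dots> \<le> (SUP n. g n x)" by (rule SUP_upper) simp
    finally show "ennreal (norm (f x) powr r) \<le> (SUP n. g n x)" .
  qed
  also have "\<dots> = (SUP n. \<integral>\<^sup>+x. g n x \<partial>M)"
  proof (rule nn_integral_monotone_convergence_SUP)
    show "incseq g"
      unfolding incseq_def le_fun_def g_def
      by (intro allI impI sum_mono2 A) (auto simp: A_def)
    show "g n \<in> borel_measurable M" for n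
      unfolding g_def by measurable
  qed
  also have "\<dots> \<le> ennreal (R * S powr r)"
  proof (rule SUP_least)
    fix n
    have "(\<integral>\<^sup>+x. g n x \<partial>M) = (\<Sum>k\<in>A n. ennreal (u k powr r) * emeasure M (ind -` {k} \<inter> space M))"
      unfolding g_def by (subst nn_integral_sum) (auto simp: nn_integral_cmult_indicator)
    also have "\<dots> \<le> (\<Sum>k\<in>A n. ennreal (u k powr r) * ennreal R)"
      by (intro sum_mono mult_left_mono R) auto
    also have "\<dots> = ennreal ((\<Sum>k\<in>A n. u k powr r) * R)"
      using R by (simp add: sum_ennreal ennreal_mult'' sum_distrib_right[symmetric] sum_nonneg)
    also have "\<dots> \<le> ennreal (S powr r * R)"
      using u A[of n] False R unfolding lq_bounded_def r_def
      by (intro ennreal_leI mult_right_mono) auto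
    finally show "(\<integral>\<^sup>+x. g n x \<partial>M) \<le> ennreal (R * S powr r)" by (simp add: mult.commute)
  qed
  finally have I: "I \<le> ennreal (R * S powr r)" .
  then have "enn2real I \<le> R * S powr r"
    using R by (intro enn2real_leI) auto
  then have "enn2real I powr (1 / r) \<le> (R * S powr r) powr (1 / r)"
    using r by (intro powr_mono2) auto
  also have "\<dots> = R powr (1 / r) * S"
    using R r S by (simp add: powr_mult powr_powr)
  also have "\<dots> \<le> R * S"
    using powr_mono[of "1 / r" 1 R] R r S by (intro mult_right_mono) auto
  finally have "ennreal (enn2real I powr (1 / r)) \<le> ennreal (R * S)"
    by (rule ennreal_leI)
  moreover have "I \<noteq> \<infinity>" using I by (auto simp: top_unique)
  ultimately show ?thesis
    using False f by (simp add: Lp_norm_def I_def r_def Let_def)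
qed

lemma Lp_norm_bounded_measurable: "Lp_norm M q f \<le> ennreal T \<Longrightarrow> f \<in> borel_measurable M"
  by (auto simp: Lp_norm_def top_unique split: if_splits)

text \<open>The disjoint sets \<open>E k\<close> have measure at least \<theta>, so the integral
  dominates \<theta> times the sum of the powers of \<open>u\<close>. As \<theta> is at most 1, the
  loss is at most \<open>1 / \<theta>\<close> for every exponent. The sets are constrained only
  where \<open>u k \<noteq> 0\<close>, because a cell may contain no point of \<Lambda>.\<close>

lemma lq_bounded_if_Lp_norm_le:
  fixes u :: "'i \<Rightarrow> real"
  assumes q: "1 \<le> q" and fT: "Lp_norm M q f \<le> ennreal T" and T: "0 \<le> T"
    and \<theta>: "0 < \<theta>" "\<theta> \<le> 1"
    and E: "\<And>k. u k \<noteq> 0 \<Longrightarrow> E k \<in> sets M" "\<And>k. u k \<noteq> 0 \<Longrightarrow> ennreal \<theta> \<le> emeasure M (E k)"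
    and disj: "\<And>k l. k \<noteq> l \<Longrightarrow> u k \<noteq> 0 \<Longrightarrow> u l \<noteq> 0 \<Longrightarrow> E k \<inter> E l = {}"
    and u: "\<And>k. 0 \<le> u k" "\<And>k y. u k \<noteq> 0 \<Longrightarrow> y \<in> E k \<Longrightarrow> u k \<le> norm (f y)"
  shows "lq_bounded q u (T / \<theta>)"
proof (cases "q = \<infinity>")
  case True
  note f = Lp_norm_bounded_measurable[OF fT]
  have "AE x in M. ennreal (norm (f x)) \<le> ennreal T"
    using esssup_AE[of "\<lambda>x. ennreal (norm (f x))" M]
  proof eventually_elim
    case (elim x)
    then show ?case using fT True f by (simp add: Lp_norm_def)
  qed
  then have AE: "AE x in M. norm (f x) \<le> T"
    using T by simp
  have "u k \<le> T" for k
  proof (rule ccontr)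
    assume k: "\<not> u k \<le> T"
    then have k0: "u k \<noteq> 0" using T by auto
    \<comment> \<open>If \<open>u k\<close> exceeded the essential supremum, \<open>E k\<close>
      would be a null set, against its measure being at least \<theta>.\<close>
    have "AE x in M. x \<notin> E k"
      using AE by eventually_elim (use u(2)[OF k0] k in force)
    then have "emeasure M (E k) = 0"
      by (subst emeasure_eq_0_AE[symmetric, of "\<lambda>x. x \<in> E k"]) (use E(1)[OF k0] sets.sets_into_space in \<open>auto intro!: arg_cong[of _ _ "emeasure M"]\<close>)
    then show False using E(2)[OF k0] \<theta> by simp
  qed
  moreover have "T \<le> T / \<theta>"
    using T \<theta> by (simp add: le_divide_eq mult_left_le)
  ultimately show ?thesis
    using True T \<theta> u(1) by (auto simp: lq_bounded_def intro: order_trans)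
next
  case False
  note f[measurable] = Lp_norm_bounded_measurable[OF fT]
  define r where "r = enn2real q"
  have r: "1 \<le> r" unfolding r_def by (rule enn2real_ge_1[OF q False])
  define I where "I = (\<integral>\<^sup>+x. ennreal (norm (f x) powr r) \<partial>M)"
  have Ifin: "I \<noteq> \<infinity>" and I1: "enn2real I powr (1 / r) \<le> T"
    using fT f False T by (auto simp: Lp_norm_def I_def r_def Let_def top_unique split: if_splits)
  have "enn2real I = (enn2real I powr (1 / r)) powr r"
    using r by (simp add: powr_powr)
  also have "\<dots> \<le> T powr r"
    using I1 r by (intro powr_mono2) auto
  finally have I: "I \<le> ennreal (T powr r)"
    using Ifin by (metis ennreal_enn2real ennreal_leI infinity_ennreal_def top.not_eq_extremum)
  have "(\<Sum>k\<in>F. \<bar>u k\<bar> powr r) \<le> (T / \<theta>) powr r" if F: "finite F" for F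
  proof -
    define G where "G = {k\<in>F. u k \<noteq> 0}"
    have G: "finite G" using F by (simp add: G_def)
    have "ennreal ((\<Sum>k\<in>G. u k powr r) * \<theta>) = (\<Sum>k\<in>G. ennreal (u k powr r) * ennreal \<theta>)"
      using \<theta> by (simp add: sum_ennreal ennreal_mult'' sum_distrib_right[symmetric] sum_nonneg)
    also have "\<dots> \<le> (\<Sum>k\<in>G. ennreal (u k powr r) * emeasure M (E k))"
      using E(2) by (intro sum_mono mult_left_mono) (auto simp: G_def)
    also have "\<dots> = (\<integral>\<^sup>+x. (\<Sum>k\<in>G. ennreal (u k powr r) * indicator (E k) x) \<partial>M)"
      using E(1) by (subst nn_integral_sum) (auto simp: nn_integral_cmult_indicator G_def)
    also have "\<dots> \<le> I"
      unfolding I_def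
    proof (rule nn_integral_mono)
      fix x
      show "(\<Sum>k\<in>G. ennreal (u k powr r) * indicator (E k) x) \<le> ennreal (norm (f x) powr r)"
      proof (cases "\<exists>k\<in>G. x \<in> E k")
        case True
        then obtain k where k: "k \<in> G" "x \<in> E k" by blast
        have "(\<Sum>l\<in>G. ennreal (u l powr r) * indicator (E l) x)
            = (\<Sum>l\<in>G. if l = k then ennreal (u l powr r) else 0)"
        proof (rule sum.cong[OF refl])
          fix l assume "l \<in> G"
          then show "ennreal (u l powr r) * indicator (E l) x = (if l = k then ennreal (u l powr r) else 0)"
            using disj[of k l] k by (auto simp: G_def indicator_def)
        qed
        also have "\<dots> = ennreal (u k powr r)" using k G by simp
        also have "\<dots> \<le> ennreal (norm (f x) powr r)"
          using k u r by (intro ennreal_leI powr_mono2) (auto simp: G_def)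
        finally show ?thesis .
      qed (auto intro: sum.neutral)
    qed
    also note I
    finally have "(\<Sum>k\<in>G. u k powr r) * \<theta> \<le> T powr r"
      by simp
    then have "(\<Sum>k\<in>G. u k powr r) \<le> T powr r / \<theta>"
      using \<theta> by (simp add: field_simps)
    also have "\<dots> \<le> T powr r / \<theta> powr r"
      using powr_mono'[of 1 r \<theta>] \<theta> r by (intro divide_left_mono) auto
    also have "\<dots> = (T / \<theta>) powr r"
      using T \<theta> by (simp add: powr_divide)
    also have "(\<Sum>k\<in>G. u k powr r) = (\<Sum>k\<in>F. \<bar>u k\<bar> powr r)"
      using F u(1) unfolding G_def by (intro sum.mono_neutral_cong_left) auto
    finally show ?thesis .
  qed
  then show ?thesis using False T \<theta> by (simp add: lq_bounded_def r_def)
qed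

section \<open>Unit cells\<close>

text \<open>
  Points \<open>x\<close> are indexed by their floor, elements of \<open>\<Lambda>\<close> by their ceiling: the elements of \<open>\<Lambda>\<close> with
  ceiling \<open>j\<close> are exactly those counted at the point \<open>j\<close> in the separation number.
\<close>

definition vfloor :: "real ^ 'd \<Rightarrow> int ^ 'd" where
  "vfloor x = (\<chi> i. \<lfloor>x $ i\<rfloor>)"

definition vceiling :: "real ^ 'd \<Rightarrow> int ^ 'd" where
  "vceiling x = (\<chi> i. \<lceil>x $ i\<rceil>)"

definition vreal :: "int ^ 'd \<Rightarrow> real ^ 'd" where
  "vreal k = (\<chi> i. of_int (k $ i))"

lemma vfloor_measurable: "vfloor \<in> measurable lborel (count_space UNIV)"
proof (subst measurable_count_space_eq_countable, simp, intro conjI ballI)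
  fix k :: "int ^ 'd"
  have [measurable]: "(\<lambda>x :: real ^ 'd. x $ i) \<in> borel_measurable borel" for i
    by (intro borel_measurable_continuous_onI continuous_intros)
  have "vfloor -` {k} \<inter> space lborel = {x \<in> space borel. \<forall>i. of_int (k $ i) \<le> x $ i \<and> x $ i < of_int (k $ i) + 1}"
    by (auto simp: vfloor_def vec_eq_iff floor_eq_iff)
  also have "\<dots> \<in> sets borel" by measurable
  finally show "vfloor -` {k} \<inter> space lborel \<in> sets lborel" by simp
qed auto

lemma emeasure_vfloor_fibre:
  fixes k :: "int ^ 'd"
  shows "emeasure lborel (vfloor -` {k}) \<le> 1"
proof -
  have "emeasure lborel (vfloor -` {k}) \<le> emeasure lborel (cbox (vreal k) (vreal k + 1))"
    by (rule emeasure_mono)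
      (auto simp: vfloor_def vreal_def vec_eq_iff floor_eq_iff mem_box_cart less_imp_le)
  also have "\<dots> = 1"
  proof -
    have b: "(1 :: real ^ 'd) \<bullet> b = 1" if "b \<in> Basis" for b
      using that by (auto simp: Basis_vec_def inner_axis)
    then show ?thesis
      by (subst emeasure_lborel_cbox) (auto simp: inner_add_left)
  qed
  finally show ?thesis .
qed

text \<open>In each coordinate there is room of length 1/2 on one side of \<open>x\<close> inside
  its cell. A box of side \<open>h\<close> placed on that side stays in the cell and near
  \<open>x\<close>, and its volume does not depend on \<open>x\<close>.\<close>

lemma emeasure_cell_near_point:
  assumes "0 < \<delta>"
  obtains \<theta> where "0 < \<theta>" "\<theta> \<le> 1"
    "\<And>x :: real ^ 'd. ennreal \<theta> \<le> emeasure lborel {y. vfloor y = vfloor x \<and> norm (y - x) \<le> \<delta>}"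
    "\<And>x :: real ^ 'd. {y. vfloor y = vfloor x \<and> norm (y - x) \<le> \<delta>} \<in> sets lborel"
proof -
  \<comment> \<open>The bound 1/2 keeps the box in the cell; the bound
    \<open>\<delta> / CARD('d)\<close> makes the l^1 distance to \<open>x\<close>, hence the
    Euclidean one, at most \<delta>.\<close>
  define h where "h = min (1 / 2) (\<delta> / CARD('d))"
  have h: "0 < h" "h \<le> 1 / 2" "CARD('d) * h \<le> \<delta>"
    using assms by (auto simp: h_def min_def field_simps)
  have meas: "{y. vfloor y = vfloor x \<and> norm (y - x) \<le> \<delta>} \<in> sets lborel" for x :: "real ^ 'd"
  proof -
    have "{y. vfloor y = vfloor x \<and> norm (y - x) \<le> \<delta>} = (vfloor -` {vfloor x} \<inter> space lborel) \<inter> cball x \<delta>"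
      by (auto simp: dist_norm norm_minus_commute)
    also have "\<dots> \<in> sets lborel"
      using measurable_sets[OF vfloor_measurable, of "{vfloor x}"] by (intro sets.Int) auto
    finally show ?thesis .
  qed
  have "ennreal (h ^ CARD('d)) \<le> emeasure lborel {y. vfloor y = vfloor x \<and> norm (y - x) \<le> \<delta>}" for x :: "real ^ 'd"
  proof -
    define a :: "real ^ 'd" where "a = (\<chi> i. if x $ i - of_int \<lfloor>x $ i\<rfloor> < 1 / 2 then x $ i else x $ i - h)"
    define b :: "real ^ 'd" where "b = a + (\<chi> i. h)"
    have "(\<chi> i. h :: real ^ 'd) \<bullet> c = h" if "c \<in> Basis" for c :: "real ^ 'd"
      using that by (auto simp: Basis_vec_def inner_axis)
    then have "ennreal (h ^ CARD('d)) = emeasure lborel (box a b)"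
      using h by (subst emeasure_lborel_box) (auto simp: b_def inner_add_left)
    also have "\<dots> \<le> emeasure lborel {y. vfloor y = vfloor x \<and> norm (y - x) \<le> \<delta>}"
    proof (rule emeasure_mono[OF _ meas], safe)
      fix y assume y: "y \<in> box a b"
      have yi: "\<lfloor>y $ i\<rfloor> = \<lfloor>x $ i\<rfloor> \<and> \<bar>y $ i - x $ i\<bar> \<le> h" for i
      proof -
        have 1: "a $ i < y $ i" "y $ i < a $ i + h"
          using y by (auto simp: mem_box_cart b_def)
        have 2: "of_int \<lfloor>x $ i\<rfloor> \<le> x $ i" "x $ i < of_int \<lfloor>x $ i\<rfloor> + 1"
          by linarith+
        show ?thesis
        proof (cases "x $ i - of_int \<lfloor>x $ i\<rfloor> < 1 / 2")
          case True
          then have "a $ i = x $ i" by (simp add: a_def)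
          then show ?thesis
            unfolding floor_eq_iff using 1 2 h(1,2) True by linarith
        next
          case False
          then have "a $ i = x $ i - h" by (simp add: a_def)
          then show ?thesis
            unfolding floor_eq_iff using 1 2 h(1,2) False by linarith
        qed
      qed
      then show "vfloor y = vfloor x" by (simp add: vfloor_def vec_eq_iff)
      have "norm (y - x) \<le> (\<Sum>i\<in>UNIV. \<bar>(y - x) $ i\<bar>)" by (rule norm_le_l1_cart)
      also have "\<dots> \<le> (\<Sum>i\<in>(UNIV::'d set). h)" using yi by (intro sum_mono) auto
      finally show "norm (y - x) \<le> \<delta>" using h(3) by simp
    qed
    finally show ?thesis .
  qed
  with meas show ?thesis
    using h by (intro that[of "h ^ CARD('d)"]) (auto intro: power_le_one)
qed

text \<open>All elements of a finite part of the fibre over \<open>j\<close> are counted at the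
  point \<open>vreal j\<close>, so such a part has at most \<open>R\<close> elements. The whole
  fibre is then finite, since it has no subset with \<open>Suc R\<close> elements.\<close>

lemma relatively_separated_fibres:
  assumes "relatively_separated \<Lambda>"
  obtains R :: nat where "1 \<le> R" "\<And>j. finite {l\<in>\<Lambda>. vceiling l = j}" "\<And>j. card {l\<in>\<Lambda>. vceiling l = j} \<le> R"
proof -
  define s where "s = enn2real (separation_number \<Lambda>)"
  have s: "separation_number \<Lambda> = ennreal s"
    using assms by (simp add: s_def relatively_separated_def)
  define R where "R = nat \<lceil>max 1 s\<rceil>"
  have R: "1 \<le> R" "s \<le> real R"
    unfolding R_def by linarith+
  have card_le: "card G \<le> R" if G: "finite G" "G \<subseteq> {l\<in>\<Lambda>. vceiling l = j}" for G j
  proof -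
    have mem: "vreal j \<in> (+) l ` half_open_cube" if "l \<in> G" for l
    proof -
      have "vceiling l = j" using G that by auto
      then have "vreal j - l \<in> half_open_cube"
        by (auto simp: vreal_def half_open_cube_def vceiling_def) linarith
      then show ?thesis by (rule rev_image_eqI) simp
    qed
    have "of_nat (card G) = (\<Sum>l\<in>G. indicator ((+) l ` half_open_cube) (vreal j) :: ennreal)"
      using mem by simp
    also have "\<dots> = (\<Sum>\<^sub>\<infinity>l\<in>G. indicator ((+) l ` half_open_cube) (vreal j))"
      using G by simp
    also have "\<dots> \<le> (\<Sum>\<^sub>\<infinity>l\<in>\<Lambda>. indicator ((+) l ` half_open_cube) (vreal j))"
      by (rule infsum_mono_neutral) (use G in \<open>auto intro: nonneg_summable_on_complete\<close>)
    also have "\<dots> \<le> separation_number \<Lambda>"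
      unfolding separation_number_def by (rule SUP_upper) simp
    finally have "ennreal (real (card G)) \<le> ennreal (real R)"
      using s R(2) by (simp add: ennreal_of_nat_eq_real_of_nat ennreal_leI order_trans)
    then show ?thesis by simp
  qed
  have fin: "finite {l\<in>\<Lambda>. vceiling l = j}" for j
  proof (rule ccontr)
    assume "infinite {l\<in>\<Lambda>. vceiling l = j}"
    then obtain G where "G \<subseteq> {l\<in>\<Lambda>. vceiling l = j}" "finite G" "card G = Suc R"
      using infinite_arbitrarily_large by blast
    then show False using card_le[of G j] by simp
  qed
  show ?thesis
    using R(1) fin card_le[OF fin] by (intro that) auto
qed

text \<open>Grouping a finite sum over \<Lambda> by cells shows that cell \<open>j\<close>
  contributes at most \<open>R * H j\<close>; sums over \<Lambda> thereby become sums over the cell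
  indices.\<close>

lemma summable_fibres:
  fixes z :: "'a \<Rightarrow> 'b::banach" and ind :: "'a \<Rightarrow> 'i"
  assumes fib: "\<And>j. finite {l\<in>\<Lambda>. ind l = j}" "\<And>j. card {l\<in>\<Lambda>. ind l = j} \<le> R"
    and H: "\<And>j. 0 \<le> H j" "H summable_on UNIV"
    and z: "\<And>l. l \<in> \<Lambda> \<Longrightarrow> norm (z l) \<le> H (ind l)"
  shows "z summable_on \<Lambda>" and "norm (infsum z \<Lambda>) \<le> real R * infsum H UNIV"
proof -
  have le: "(\<Sum>l\<in>G. H (ind l)) \<le> real R * infsum H UNIV" if G: "finite G" "G \<subseteq> \<Lambda>" for G
  proof -
    have "(\<Sum>l\<in>G. H (ind l)) = (\<Sum>j\<in>ind ` G. \<Sum>l\<in>{l\<in>G. ind l = j}. H (ind l))"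
      by (rule sum.image_gen[OF G(1)])
    also have "\<dots> = (\<Sum>j\<in>ind ` G. real (card {l\<in>G. ind l = j}) * H j)"
      by (intro sum.cong) auto
    also have "\<dots> \<le> (\<Sum>j\<in>ind ` G. real R * H j)"
    proof (intro sum_mono mult_right_mono H)
      fix j
      have "card {l\<in>G. ind l = j} \<le> card {l\<in>\<Lambda>. ind l = j}"
        using G by (intro card_mono fib) auto
      then show "real (card {l\<in>G. ind l = j}) \<le> real R"
        using fib(2)[of j] by simp
    qed
    also have "\<dots> = real R * (\<Sum>j\<in>ind ` G. H j)"
      by (simp add: sum_distrib_left)
    also have "\<dots> \<le> real R * infsum H UNIV"
      using G H by (intro mult_left_mono finite_sum_le_infsum) auto
    finally show ?thesis .
  qed
  have s: "(\<lambda>l. H (ind l)) summable_on \<Lambda>"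
    by (rule nonneg_bdd_above_summable_on) (auto intro!: bdd_aboveI le H(1))
  show "z summable_on \<Lambda>"
    by (rule summable_on_dominated[OF s z])
  have "norm (infsum z \<Lambda>) \<le> (\<Sum>\<^sub>\<infinity>l\<in>\<Lambda>. H (ind l))"
    by (rule norm_infsum_le_dominated[OF s z])
  also have "\<dots> \<le> real R * infsum H UNIV"
    by (rule infsum_le_finite_sums[OF s le])
  finally show "norm (infsum z \<Lambda>) \<le> real R * infsum H UNIV" .
qed

section \<open>Amalgam norms and summable kernels on the integer lattice\<close>

lemma wiener_amalgam_dominating:
  fixes g :: "real ^ 'd \<Rightarrow> ennreal"
  assumes g: "wiener_amalgam_norm g \<le> ennreal \<epsilon>" and \<epsilon>: "0 \<le> \<epsilon>"
  obtains w :: "int ^ 'd \<Rightarrow> real" where "\<And>k. 0 \<le> w k" "w summable_on UNIV" "infsum w UNIV \<le> \<epsilon>"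
    "\<And>x. g x \<le> ennreal (w (vfloor x))"
proof -
  define s where "s k = (SUP x\<in>half_open_cube. g (k + x))" for k :: "real ^ 'd"
  have fin_sum: "(\<Sum>k\<in>F. s (vreal k)) \<le> ennreal \<epsilon>" if "finite F" for F
  proof -
    have inj: "inj_on vreal F" by (auto simp: inj_on_def vreal_def vec_eq_iff)
    have "(\<Sum>k\<in>F. s (vreal k)) = (\<Sum>k\<in>vreal ` F. s k)"
      using inj by (simp add: sum.reindex)
    also have "\<dots> = (\<Sum>\<^sub>\<infinity>k\<in>vreal ` F. s k)"
      using that by simp
    also have "\<dots> \<le> (\<Sum>\<^sub>\<infinity>k\<in>integer_lattice. s k)"
      by (rule infsum_mono_neutral)
        (auto simp: vreal_def integer_lattice_def intro: nonneg_summable_on_complete)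
    also have "\<dots> \<le> ennreal \<epsilon>"
      using g by (simp add: wiener_amalgam_norm_def s_def)
    finally show ?thesis .
  qed
  define w where "w k = enn2real (s (vreal k))" for k
  have w_eq: "s (vreal k) = ennreal (w k)" for k
  proof -
    have "s (vreal k) \<le> ennreal \<epsilon>" using fin_sum[of "{k}"] by simp
    then have "s (vreal k) < top" using le_less_trans ennreal_less_top by blast
    then show ?thesis by (simp add: w_def)
  qed
  have w0: "0 \<le> w k" for k by (simp add: w_def)
  have w_sum: "sum w F \<le> \<epsilon>" if "finite F" for F
    using fin_sum[OF that] \<epsilon> by (simp add: w_eq w0 sum_ennreal)
  show ?thesis
  proof
    show "0 \<le> w k" for k by (rule w0)
    show sw: "w summable_on UNIV"
      by (rule nonneg_bdd_above_summable_on) (auto intro!: bdd_aboveI w_sum w0)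
    show "infsum w UNIV \<le> \<epsilon>"
      by (rule infsum_le_finite_sums[OF sw w_sum])
    fix x :: "real ^ 'd"
    have "x - vreal (vfloor x) \<in> half_open_cube"
      by (auto simp: half_open_cube_def vreal_def vfloor_def) linarith
    then have "g (vreal (vfloor x) + (x - vreal (vfloor x))) \<le> s (vreal (vfloor x))"
      unfolding s_def by (rule SUP_upper)
    then show "g x \<le> ennreal (w (vfloor x))" by (simp add: w_eq)
  qed
qed

lemma
  fixes f :: "'a \<Rightarrow> 'b \<Rightarrow> real"
  assumes "finite E" "\<And>e. e \<in> E \<Longrightarrow> f e summable_on A"
  shows summable_on_finite_sum: "(\<lambda>k. \<Sum>e\<in>E. f e k) summable_on A"
    and infsum_finite_sum: "(\<Sum>\<^sub>\<infinity>k\<in>A. \<Sum>e\<in>E. f e k) = (\<Sum>e\<in>E. infsum (f e) A)"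
proof -
  have "(\<lambda>k. \<Sum>e\<in>E. f e k) summable_on A \<and> (\<Sum>\<^sub>\<infinity>k\<in>A. \<Sum>e\<in>E. f e k) = (\<Sum>e\<in>E. infsum (f e) A)"
    using assms by (induction E) (auto simp: infsum_add summable_on_add)
  then show "(\<lambda>k. \<Sum>e\<in>E. f e k) summable_on A"
    "(\<Sum>\<^sub>\<infinity>k\<in>A. \<Sum>e\<in>E. f e k) = (\<Sum>e\<in>E. infsum (f e) A)"
    by auto
qed

text \<open>The possible values of \<open>vfloor (x - l) - (vfloor x - vceiling l)\<close>: in each
  coordinate two fractional parts in [0, 1) add up, with carry 0 or 1.\<close>

definition unit_corners :: "(int ^ 'd) set" where
  "unit_corners = {e. \<forall>i. e $ i \<in> {0, 1}}"

lemma finite_unit_corners: "finite (unit_corners :: (int ^ 'd) set)"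
proof (rule finite_subset)
  show "unit_corners \<subseteq> vec_lambda ` (UNIV \<rightarrow>\<^sub>E {0, 1::int} :: ('d \<Rightarrow> int) set)"
    by (auto simp: unit_corners_def intro!: image_eqI[where x = "vec_nth _"])
  show "finite (vec_lambda ` (UNIV \<rightarrow>\<^sub>E {0, 1::int} :: ('d \<Rightarrow> int) set))"
    by (intro finite_imageI finite_PiE) auto
qed

text \<open>The kernel must depend only on the cells of \<open>x\<close> and \<open>l\<close>, which
  determine the cell of \<open>x - l\<close> up to a unit corner. Summing \<open>w\<close> over all
  corners removes the ambiguity, at the cost of their number as a factor.\<close>

lemma wiener_amalgam_translates:
  fixes g :: "real ^ 'd \<Rightarrow> ennreal"
  assumes g: "wiener_amalgam_norm g \<le> ennreal \<epsilon>" and \<epsilon>: "0 \<le> \<epsilon>"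
  obtains W :: "int ^ 'd \<Rightarrow> real" where "\<And>k. 0 \<le> W k" "W summable_on UNIV"
    "infsum W UNIV \<le> real (card (unit_corners :: (int ^ 'd) set)) * \<epsilon>"
    "\<And>x l. g (x - l) \<le> ennreal (W (vfloor x - vceiling l))"
proof -
  obtain w :: "int ^ 'd \<Rightarrow> real" where w: "\<And>k. 0 \<le> w k" "w summable_on UNIV" "infsum w UNIV \<le> \<epsilon>"
    "\<And>x. g x \<le> ennreal (w (vfloor x))"
    by (rule wiener_amalgam_dominating[OF g \<epsilon>]) blast
  let ?E = "unit_corners :: (int ^ 'd) set"
  have sw: "(\<lambda>k. w (k + e)) summable_on UNIV" "(\<Sum>\<^sub>\<infinity>k. w (k + e)) = infsum w UNIV" for e
    using infsum_shift(1,3)[of w "- e"] w(2) by auto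
  show ?thesis
  proof (rule that[of "\<lambda>k. \<Sum>e\<in>?E. w (k + e)"])
    show "0 \<le> (\<Sum>e\<in>?E. w (k + e))" for k using w by (simp add: sum_nonneg)
    show "(\<lambda>k. \<Sum>e\<in>?E. w (k + e)) summable_on UNIV"
      using finite_unit_corners by (intro summable_on_finite_sum sw)
    have "(\<Sum>\<^sub>\<infinity>k. \<Sum>e\<in>?E. w (k + e)) = (\<Sum>e\<in>?E. \<Sum>\<^sub>\<infinity>k. w (k + e))"
      using finite_unit_corners by (intro infsum_finite_sum sw)
    also have "\<dots> = real (card ?E) * infsum w UNIV"
      by (simp add: sw)
    also have "\<dots> \<le> real (card ?E) * \<epsilon>"
      using w by (intro mult_left_mono) auto
    finally show "(\<Sum>\<^sub>\<infinity>k. \<Sum>e\<in>?E. w (k + e)) \<le> real (card ?E) * \<epsilon>" .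
    fix x l :: "real ^ 'd"
    define e where "e = vfloor (x - l) - (vfloor x - vceiling l)"
    have "e \<in> ?E"
    proof -
      have "e $ i = 0 \<or> e $ i = 1" for i
        unfolding e_def vfloor_def vceiling_def by simp linarith
      then show ?thesis by (auto simp: unit_corners_def)
    qed
    have "g (x - l) \<le> ennreal (w (vfloor x - vceiling l + e))"
      using w(4)[of "x - l"] by (simp add: e_def)
    also have "\<dots> \<le> ennreal (\<Sum>e\<in>?E. w (vfloor x - vceiling l + e))"
      using \<open>e \<in> ?E\<close> w finite_unit_corners
      by (intro ennreal_leI member_le_sum) auto
    finally show "g (x - l) \<le> ennreal (\<Sum>e\<in>?E. w (vfloor x - vceiling l + e))" .
  qed
qed

lemma summable_mult_translate:
  fixes u w :: "'i::ab_group_add \<Rightarrow> real"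
  assumes "\<And>k. 0 \<le> w k" "w summable_on UNIV" "\<And>j. \<bar>u j\<bar> \<le> B"
  shows "(\<lambda>j. u j * w (k - j)) summable_on UNIV"
proof -
  have "(\<lambda>j. w (k - j) * u j) summable_on UNIV"
    by (rule summable_on_mult_bounded[where B = B]) (use assms infsum_shift(4)[of w k] in auto)
  then show ?thesis by (simp add: mult.commute)
qed

lemma convolution_sup_bound:
  fixes w u :: "'i::ab_group_add \<Rightarrow> real"
  assumes "\<And>k. 0 \<le> w k" "w summable_on UNIV" "\<And>j. 0 \<le> u j" "\<And>j. u j \<le> B"
  shows "(\<Sum>\<^sub>\<infinity>j. u j * w (k - j)) \<le> infsum w UNIV * B"
proof -
  have "0 \<le> B" using assms(3,4) order_trans by blast
  then have "lq_bounded \<infinity> u B"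
    using assms(3,4) by (simp add: lq_bounded_def)
  from lq_bounded_point[OF lq_bounded_convolution[OF _ this assms(1,2)], of k] show ?thesis
    by (simp add: abs_le_iff)
qed

section \<open>Stability of the synthesis operator\<close>

text \<open>The discrete form of the hypotheses: a bound on the number of points per cell, a
  summable kernel \<open>W\<close> for the size of the family, and kernels \<open>V\<close> of
  arbitrarily small mass for its oscillation.\<close>

locale localized_family =
  fixes \<Lambda> :: "(real ^ 'd) set" and \<phi> :: "real ^ 'd \<Rightarrow> real ^ 'd \<Rightarrow> complex"
    and R :: nat and W :: "int ^ 'd \<Rightarrow> real"
  assumes R: "1 \<le> R"
    and fibres: "\<And>j. finite {l\<in>\<Lambda>. vceiling l = j}" "\<And>j. card {l\<in>\<Lambda>. vceiling l = j} \<le> R"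
    and W: "\<And>k. 0 \<le> W k" "W summable_on UNIV"
    and decay: "\<And>l x. l \<in> \<Lambda> \<Longrightarrow> norm (\<phi> l x) \<le> W (vfloor x - vceiling l)"
    and equicontinuous: "\<And>\<epsilon>. 0 < \<epsilon> \<Longrightarrow> \<exists>\<delta>>0. \<exists>V. (\<forall>k. 0 \<le> V k) \<and> V summable_on UNIV \<and> infsum V UNIV \<le> \<epsilon> \<and>
        (\<forall>l\<in>\<Lambda>. \<forall>x y. norm y \<le> \<delta> \<longrightarrow> norm (\<phi> l (x + y) - \<phi> l x) \<le> V (vfloor x - vceiling l))"
begin

text \<open>Together with \<open>cell_attained\<close> this describes the cell maxima of
  \<open>c\<close>. The two halves are separate because upper estimates use domination alone, while
  bounding \<open>u\<close> by the norm of \<open>c\<close> uses attainment alone.\<close>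

definition cell_dominated :: "(real ^ 'd \<Rightarrow> complex) \<Rightarrow> (int ^ 'd \<Rightarrow> real) \<Rightarrow> bool" where
  "cell_dominated c u \<longleftrightarrow> (\<forall>j. 0 \<le> u j) \<and> (\<forall>l\<in>\<Lambda>. norm (c l) \<le> u (vceiling l))"

definition cell_attained :: "(real ^ 'd \<Rightarrow> complex) \<Rightarrow> (int ^ 'd \<Rightarrow> real) \<Rightarrow> bool" where
  "cell_attained c u \<longleftrightarrow> (\<forall>j. 0 \<le> u j) \<and> (\<forall>j. u j \<noteq> 0 \<longrightarrow> (\<exists>l\<in>\<Lambda>. vceiling l = j \<and> u j \<le> norm (c l)))"

lemma cell_maximum_exists:
  obtains u where "cell_dominated c u" "cell_attained c u"
proof -
  \<comment> \<open>The inserted 0 gives empty cells the maximum 0.\<close>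
  define A where "A j = insert 0 ((\<lambda>l. norm (c l)) ` {l\<in>\<Lambda>. vceiling l = j})" for j
  have A: "finite (A j)" "A j \<noteq> {}" "0 \<in> A j" for j
    using fibres(1) by (auto simp: A_def)
  define u where "u j = Max (A j)" for j
  have u0: "0 \<le> u j" for j
    unfolding u_def by (rule Max_ge[OF A(1,3)])
  have "cell_dominated c u"
    unfolding cell_dominated_def
  proof (intro conjI allI u0 ballI)
    fix l assume "l \<in> \<Lambda>"
    then have "norm (c l) \<in> A (vceiling l)" by (auto simp: A_def)
    then show "norm (c l) \<le> u (vceiling l)"
      unfolding u_def by (rule Max_ge[OF A(1)])
  qed
  moreover have "cell_attained c u"
    unfolding cell_attained_def
  proof (intro conjI allI u0 impI)
    fix j assume "u j \<noteq> 0"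
    moreover have "u j \<in> A j"
      unfolding u_def by (rule Max_in[OF A(1,2)])
    ultimately obtain l where "l \<in> \<Lambda>" "vceiling l = j" "u j = norm (c l)"
      by (auto simp: A_def)
    then show "\<exists>l\<in>\<Lambda>. vceiling l = j \<and> u j \<le> norm (c l)" by auto
  qed
  ultimately show ?thesis by (rule that)
qed

text \<open>One maximizing point is picked in each cell where \<open>u\<close> is nonzero; these
  points are distinct, and each has counting measure 1.\<close>

lemma lq_bounded_if_cell_attained:
  assumes q: "1 \<le> q" and c: "Lp_norm (count_space \<Lambda>) q c \<le> ennreal T" "0 \<le> T" and u: "cell_attained c u"
  shows "lq_bounded q u T"
proof -
  define e where "e j = (SOME l. l \<in> \<Lambda> \<and> vceiling l = j \<and> u j \<le> norm (c l))" for j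
  have e: "e j \<in> \<Lambda>" "vceiling (e j) = j" "u j \<le> norm (c (e j))" if "u j \<noteq> 0" for j
    using someI_ex[of "\<lambda>l. l \<in> \<Lambda> \<and> vceiling l = j \<and> u j \<le> norm (c l)"] u that
    by (auto simp: cell_attained_def e_def)
  have "lq_bounded q u (T / 1)"
  proof (rule lq_bounded_if_Lp_norm_le[OF q c, where E = "\<lambda>j. {e j}"])
    show "{e k} \<inter> {e l} = {}" if "k \<noteq> l" "u k \<noteq> 0" "u l \<noteq> 0" for k l
      using e(2)[of k] e(2)[of l] that by auto
  qed (use e u in \<open>auto simp: cell_attained_def\<close>)
  then show ?thesis by simp
qed

lemma Lp_norm_le_cell_dominated:
  assumes q: "1 \<le> q" and u: "cell_dominated c u" "lq_bounded q u T"
  shows "Lp_norm (count_space \<Lambda>) q c \<le> ennreal (real R * T)"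
proof (rule Lp_norm_le_lq_bounded[OF q, where ind = vceiling and u = u])
  fix k
  have "vceiling -` {k} \<inter> space (count_space \<Lambda>) = {l\<in>\<Lambda>. vceiling l = k}" by auto
  then show "emeasure (count_space \<Lambda>) (vceiling -` {k} \<inter> space (count_space \<Lambda>)) \<le> ennreal (real R)"
    using fibres[of k] by (auto simp: emeasure_count_space_finite ennreal_of_nat_eq_real_of_nat[symmetric])
qed (use R u in \<open>auto simp: cell_dominated_def\<close>)

text \<open>The common source of the bounds for synthesis, for its increments, and for its
  commutator with a window.\<close>

lemma weighted_sum_bound:
  fixes w u :: "int ^ 'd \<Rightarrow> real"
  assumes w: "\<And>k. 0 \<le> w k" "w summable_on UNIV" and u: "\<And>j. 0 \<le> u j" "\<And>j. u j \<le> B"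
    and c: "\<And>l. l \<in> \<Lambda> \<Longrightarrow> norm (c l) \<le> u (vceiling l)"
    and z: "\<And>l. l \<in> \<Lambda> \<Longrightarrow> norm (z l) \<le> w (k - vceiling l)"
  shows "(\<lambda>l. c l * z l :: complex) summable_on \<Lambda>"
    and "norm (\<Sum>\<^sub>\<infinity>l\<in>\<Lambda>. c l * z l) \<le> real R * (\<Sum>\<^sub>\<infinity>j. u j * w (k - j))"
proof -
  have H: "(\<lambda>j. u j * w (k - j)) summable_on UNIV"
    by (rule summable_mult_translate[OF w]) (use u in \<open>auto simp: abs_of_nonneg\<close>)
  have *: "norm (c l * z l) \<le> u (vceiling l) * w (k - vceiling l)" if "l \<in> \<Lambda>" for l
    unfolding norm_mult by (rule mult_mono[OF c z]) (use that u in auto)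
  note s = summable_fibres[OF fibres _ H, where z = "\<lambda>l. c l * z l", OF _ *]
  show "(\<lambda>l. c l * z l) summable_on \<Lambda>"
    by (rule s(1)) (use w u in auto)
  show "norm (\<Sum>\<^sub>\<infinity>l\<in>\<Lambda>. c l * z l) \<le> real R * (\<Sum>\<^sub>\<infinity>j. u j * w (k - j))"
    by (rule s(2)) (use w u in auto)
qed

section \<open>Pointwise and norm estimates for the synthesis operator\<close>

abbreviation synth :: "(real ^ 'd \<Rightarrow> complex) \<Rightarrow> real ^ 'd \<Rightarrow> complex" where
  "synth \<equiv> synthesis_operator \<Lambda> \<phi>"

lemma synth_summable:
  assumes "cell_dominated c u" "\<And>j. u j \<le> B"
  shows "(\<lambda>l. c l * \<phi> l x) summable_on \<Lambda>"
  by (rule weighted_sum_bound(1)[OF W, of u B]) (use assms decay in \<open>auto simp: cell_dominated_def\<close>)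

lemma norm_synth_le:
  assumes "cell_dominated c u" "\<And>j. u j \<le> B"
  shows "norm (synth c x) \<le> real R * (\<Sum>\<^sub>\<infinity>j. u j * W (vfloor x - j))"
  unfolding synthesis_operator_def
  by (rule weighted_sum_bound(2)[OF W, of u B]) (use assms decay in \<open>auto simp: cell_dominated_def\<close>)

lemma norm_synth_diff_le:
  assumes u: "cell_dominated c u" "\<And>j. u j \<le> B"
    and V: "\<And>k. 0 \<le> V k" "V summable_on UNIV"
      "\<And>l. l \<in> \<Lambda> \<Longrightarrow> norm (\<phi> l (x + y) - \<phi> l x) \<le> V (vfloor x - vceiling l)"
  shows "norm (synth c (x + y) - synth c x) \<le> real R * (\<Sum>\<^sub>\<infinity>j. u j * V (vfloor x - j))"
proof -
  have "synth c (x + y) - synth c x = (\<Sum>\<^sub>\<infinity>l\<in>\<Lambda>. c l * \<phi> l (x + y)) + (\<Sum>\<^sub>\<infinity>l\<in>\<Lambda>. - (c l * \<phi> l x))"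
    by (simp add: synthesis_operator_def infsum_uminus)
  also have "\<dots> = (\<Sum>\<^sub>\<infinity>l\<in>\<Lambda>. c l * \<phi> l (x + y) + - (c l * \<phi> l x))"
    by (intro infsum_add[symmetric] summable_on_uminus[THEN iffD2] synth_summable[OF u])
  also have "\<dots> = (\<Sum>\<^sub>\<infinity>l\<in>\<Lambda>. c l * (\<phi> l (x + y) - \<phi> l x))"
    by (simp add: right_diff_distrib)
  also have "norm \<dots> \<le> real R * (\<Sum>\<^sub>\<infinity>j. u j * V (vfloor x - j))"
    by (rule weighted_sum_bound(2)[OF V(1,2), of u B]) (use u V(3) in \<open>auto simp: cell_dominated_def\<close>)
  finally show ?thesis .
qed

text \<open>\<open>Lp_norm\<close> is infinite on nonmeasurable functions, so upper bounds need this
  first. For bounded coefficients the synthesized function is even continuous, because its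
  increments are dominated by convolution with a kernel of small mass.\<close>

lemma synth_measurable:
  assumes u: "cell_dominated c u" "\<And>j. u j \<le> B"
  shows "synth c \<in> borel_measurable lborel"
proof -
  have B: "0 \<le> B" using u by (auto simp: cell_dominated_def intro: order_trans)
  have "continuous_on UNIV (synth c)"
    unfolding continuous_on_iff
  proof (intro ballI allI impI)
    fix x :: "real ^ 'd" and e :: real assume e: "0 < e"
    \<comment> \<open>Makes the increment bound \<open>R * (\<epsilon> * B)\<close> strictly less
      than \<open>e\<close>; the summand 1 covers \<open>B = 0\<close>.\<close>
    define \<epsilon> where "\<epsilon> = e / (2 * (real R * B + 1))"
    have \<epsilon>: "0 < \<epsilon>" using e B by (simp add: \<epsilon>_def add_nonneg_pos)
    from equicontinuous[OF \<epsilon>] obtain \<delta> V where \<delta>: "0 < \<delta>"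
      and V: "\<And>k. 0 \<le> V k" "V summable_on UNIV" "infsum V UNIV \<le> \<epsilon>"
      and \<phi>V: "\<And>l x y. l \<in> \<Lambda> \<Longrightarrow> norm y \<le> \<delta> \<Longrightarrow> norm (\<phi> l (x + y) - \<phi> l x) \<le> V (vfloor x - vceiling l)"
      by blast
    have "dist (synth c z) (synth c x) < e" if "dist z x < \<delta>" for z
    proof -
      have "norm (synth c (x + (z - x)) - synth c x) \<le> real R * (\<Sum>\<^sub>\<infinity>j. u j * V (vfloor x - j))"
        by (rule norm_synth_diff_le[OF u V(1,2) \<phi>V]) (use that in \<open>auto simp: dist_norm\<close>)
      also have "\<dots> \<le> real R * (\<epsilon> * B)"
      proof (rule mult_left_mono)
        have "(\<Sum>\<^sub>\<infinity>j. u j * V (vfloor x - j)) \<le> infsum V UNIV * B"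
          by (rule convolution_sup_bound[OF V(1,2)]) (use u in \<open>auto simp: cell_dominated_def\<close>)
        also have "\<dots> \<le> \<epsilon> * B" by (rule mult_right_mono[OF V(3) B])
        finally show "(\<Sum>\<^sub>\<infinity>j. u j * V (vfloor x - j)) \<le> \<epsilon> * B" .
      qed simp
      also have "\<dots> < \<epsilon> * (2 * (real R * B + 1))"
        using \<epsilon> B by (simp add: algebra_simps add_pos_nonneg)
      also have "\<dots> = e"
        using B by (simp add: \<epsilon>_def add_nonneg_pos less_imp_neq[symmetric])
      finally show ?thesis by (simp add: dist_norm)
    qed
    then show "\<exists>d>0. \<forall>z\<in>UNIV. dist z x < d \<longrightarrow> dist (synth c z) (synth c x) < e"
      using \<delta> by blast
  qed
  then show ?thesis
    by (simp add: borel_measurable_continuous_onI)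
qed

lemma Lp_norm_synth_le:
  assumes q: "1 \<le> q" and u: "cell_dominated c u" "\<And>j. u j \<le> B"
    and v: "\<And>k. 0 \<le> v k" "\<And>x. norm (synth c x) \<le> v (vfloor x)" "lq_bounded q v T"
  shows "Lp_norm lborel q (synth c) \<le> ennreal T"
proof -
  have "Lp_norm lborel q (synth c) \<le> ennreal (1 * T)"
    by (rule Lp_norm_le_lq_bounded[OF q synth_measurable[OF u] vfloor_measurable _ _ _ v(1,3)])
      (use v(2) emeasure_vfloor_fibre in auto)
  then show ?thesis by simp
qed

lemma synth_upper_bound:
  assumes q: "1 \<le> q" and u: "cell_dominated c u" "lq_bounded q u T"
  shows "Lp_norm lborel q (synth c) \<le> ennreal (real R * (infsum W UNIV * T))"
proof -
  have uT: "u j \<le> T" for j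
    using lq_bounded_point[OF u(2) q, of j] by simp
  have u0: "0 \<le> u j" for j using u by (simp add: cell_dominated_def)
  show ?thesis
  proof (rule Lp_norm_synth_le[OF q u(1) uT])
    show "0 \<le> real R * (\<Sum>\<^sub>\<infinity>j. u j * W (k - j))" for k
      using u0 W by (intro mult_nonneg_nonneg infsum_nonneg) auto
    show "norm (synth c x) \<le> real R * (\<Sum>\<^sub>\<infinity>j. u j * W (vfloor x - j))" for x
      by (rule norm_synth_le[OF u(1) uT])
    show "lq_bounded q (\<lambda>k. real R * (\<Sum>\<^sub>\<infinity>j. u j * W (k - j))) (real R * (infsum W UNIV * T))"
      by (intro lq_bounded_cmult lq_bounded_convolution q u W) simp
  qed
qed

text \<open>Each window value is replaced by the value at the cell of \<open>x\<close>, which then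
  factors out of the series. The error carries the differences of window values, in the shape that
  \<open>lq_bounded_localization\<close> expects with kernel \<open>R * W\<close>.\<close>

lemma synth_window:
  fixes \<psi> :: "int ^ 'd \<Rightarrow> real"
  assumes u: "cell_dominated c u" "\<And>j. u j \<le> B" and \<psi>: "\<And>j. \<bar>\<psi> j\<bar> \<le> 1"
  shows "norm (synth (\<lambda>l. of_real (\<psi> (vceiling l)) * c l) x)
    \<le> \<bar>\<psi> (vfloor x)\<bar> * norm (synth c x)
      + (\<Sum>\<^sub>\<infinity>j. real R * W (vfloor x - j) * \<bar>\<psi> j - \<psi> (vfloor x)\<bar> * u j)"
proof -
  let ?k = "vfloor x"
  have u0: "0 \<le> u j" for j using u by (simp add: cell_dominated_def)
  have B: "0 \<le> B" using u0 u(2) order_trans by blast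
  define d where "d l = of_real (\<psi> (vceiling l) - \<psi> ?k) * c l" for l
  define v where "v j = \<bar>\<psi> j - \<psi> ?k\<bar> * u j" for j
  have v: "v j \<le> 2 * B" for j
    unfolding v_def using \<psi>[of j] \<psi>[of ?k] u(2)[of j] u0[of j] by (intro mult_mono) auto
  have v0: "0 \<le> v j" for j unfolding v_def using u0[of j] by simp
  have d: "norm (d l) \<le> v (vceiling l)" if "l \<in> \<Lambda>" for l
    using u(1) that unfolding d_def v_def norm_mult norm_of_real
    by (intro mult_left_mono) (auto simp: cell_dominated_def)
  note ws = weighted_sum_bound[where w = W and u = v and c = d and z = "\<lambda>l. \<phi> l x" and k = ?k, OF W v0 v d decay]
  have "synth (\<lambda>l. of_real (\<psi> (vceiling l)) * c l) x
      = (\<Sum>\<^sub>\<infinity>l\<in>\<Lambda>. of_real (\<psi> ?k) * (c l * \<phi> l x) + d l * \<phi> l x)"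
    unfolding synthesis_operator_def d_def by (intro infsum_cong) (simp add: algebra_simps)
  also have "\<dots> = (\<Sum>\<^sub>\<infinity>l\<in>\<Lambda>. of_real (\<psi> ?k) * (c l * \<phi> l x)) + (\<Sum>\<^sub>\<infinity>l\<in>\<Lambda>. d l * \<phi> l x)"
    by (intro infsum_add summable_on_cmult_right synth_summable[OF u] ws(1)) auto
  also have "(\<Sum>\<^sub>\<infinity>l\<in>\<Lambda>. of_real (\<psi> ?k) * (c l * \<phi> l x)) = of_real (\<psi> ?k) * synth c x"
    unfolding synthesis_operator_def by (rule infsum_cmult_right')
  finally have "norm (synth (\<lambda>l. of_real (\<psi> (vceiling l)) * c l) x)
      \<le> \<bar>\<psi> ?k\<bar> * norm (synth c x) + norm (\<Sum>\<^sub>\<infinity>l\<in>\<Lambda>. d l * \<phi> l x)"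
    using norm_triangle_ineq[of "of_real (\<psi> ?k) * synth c x" "\<Sum>\<^sub>\<infinity>l\<in>\<Lambda>. d l * \<phi> l x"]
    by (simp add: norm_mult)
  also have "norm (\<Sum>\<^sub>\<infinity>l\<in>\<Lambda>. d l * \<phi> l x) \<le> real R * (\<Sum>\<^sub>\<infinity>j. v j * W (?k - j))"
    by (rule ws(2)) auto
  also have "\<dots> = (\<Sum>\<^sub>\<infinity>j. real R * W (?k - j) * \<bar>\<psi> j - \<psi> ?k\<bar> * u j)"
    unfolding infsum_cmult_right'[symmetric] v_def by (intro infsum_cong) (simp add: mult_ac)
  finally show ?thesis by simp
qed

text \<open>Applying p-stability to the windowed coefficients provides the hypothesis
  \<open>stable\<close> of \<open>lq_bounded_localization\<close>. The bound is still in terms of a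
  cellwise majorant \<open>h\<close> of the synthesized function, not of its L^q norm.\<close>

lemma localized_lower_bound:
  assumes p: "1 \<le> p" and q: "1 \<le> q" and stable: "lp_stable \<Lambda> \<phi> p"
  obtains K where "0 \<le> K"
    "\<And>c u h S F. cell_dominated c u \<Longrightarrow> cell_attained c u \<Longrightarrow> lq_bounded q u S \<Longrightarrow>
      (\<And>k. 0 \<le> h k) \<Longrightarrow> (\<And>x. norm (synth c x) \<le> h (vfloor x)) \<Longrightarrow> lq_bounded q h F \<Longrightarrow>
      lq_bounded q u (K * F)"
proof -
  obtain C where C: "0 < C"
    and lower: "\<And>c. c \<in> Lp_space (count_space \<Lambda>) p \<Longrightarrow>
      ennreal (inverse C) * Lp_norm (count_space \<Lambda>) p c \<le> Lp_norm lborel p (synth c)"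
    using stable by (auto simp: lp_stable_def)
  \<comment> \<open>The threshold is the one at which \<open>lq_bounded_localization\<close> can
    absorb the commutator.\<close>
  obtain N where N: "0 < N" and small: "(\<Sum>\<^sub>\<infinity>i. real R * W i * min 1 (l1_norm i / N)) \<le> 1 / (4 * C)"
    by (rule window_scale_exists[of "\<lambda>i. real R * W i" "1 / (4 * C)"])
      (use W C in \<open>auto intro: summable_on_cmult_right\<close>)
  let ?\<psi> = "exp_window N :: int ^ 'd \<Rightarrow> real"
  define K where "K = 2 * (C * infsum ?\<psi> UNIV)"
  have \<psi>0: "0 \<le> ?\<psi> i" and \<psi>1: "\<bar>?\<psi> i\<bar> \<le> 1" for i
    using N l1_norm_nonneg[of i] by (auto simp: exp_window_def)
  note s\<psi> = summable_exp_window[OF N, where 'd = 'd]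
  show ?thesis
  proof (rule that[of K])
    show "0 \<le> K" unfolding K_def using C \<psi>0 by (simp add: infsum_nonneg)
    fix c u h S F
    assume u: "cell_dominated c u" "cell_attained c u" "lq_bounded q u S"
      and h: "\<And>k. 0 \<le> h k" "\<And>x. norm (synth c x) \<le> h (vfloor x)" "lq_bounded q h F"
    have u0: "0 \<le> u j" for j using u by (simp add: cell_dominated_def)
    have uS: "u j \<le> S" for j using lq_bounded_point[OF u(3) q, of j] by simp
    have "lq_bounded q u (2 * (C * infsum ?\<psi> UNIV * F))"
    proof (rule lq_bounded_localization[OF p q \<psi>0 s\<psi> _ exp_window_slow[OF N], where W = "\<lambda>i. real R * W i"])
      show "?\<psi> 0 = 1" by (simp add: exp_window_def l1_norm_def)
      show "0 \<le> min 1 (l1_norm i / N)" for i :: "int ^ 'd"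
        using N l1_norm_nonneg[of i] by simp
      then show "(\<lambda>i. real R * W i * min 1 (l1_norm i / N)) summable_on UNIV"
        by (intro summable_on_mult_bounded[where B = 1] summable_on_cmult_right W) (auto simp: W)
      show "4 * C * (\<Sum>\<^sub>\<infinity>i. real R * W i * min 1 (l1_norm i / N)) \<le> 1"
        using small C by (simp add: field_simps)
      fix n T
      define v where "v k = ?\<psi> (k - n) * h k
          + (\<Sum>\<^sub>\<infinity>j. real R * W (k - j) * \<bar>?\<psi> (j - n) - ?\<psi> (k - n)\<bar> * u j)" for k
      assume "lq_bounded p (\<lambda>k. ?\<psi> (k - n) * h k
          + (\<Sum>\<^sub>\<infinity>j. real R * W (k - j) * \<bar>?\<psi> (j - n) - ?\<psi> (k - n)\<bar> * u j)) T"
      then have v: "lq_bounded p v T" by (simp add: v_def[abs_def])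
      \<comment> \<open>The window depends on \<open>l\<close> only through its cell, so multiplying
        by it multiplies the cell maxima and preserves domination and attainment.\<close>
      define d where "d l = of_real (?\<psi> (vceiling l - n)) * c l" for l
      define u' where "u' j = ?\<psi> (j - n) * u j" for j
      have dom: "cell_dominated d u'"
        unfolding cell_dominated_def
      proof (intro conjI allI ballI)
        show "0 \<le> u' j" for j using \<psi>0 u0 by (simp add: u'_def)
        fix l assume "l \<in> \<Lambda>"
        then have "norm (c l) \<le> u (vceiling l)"
          using u(1) by (simp add: cell_dominated_def)
        then show "norm (d l) \<le> u' (vceiling l)"
          unfolding d_def u'_def norm_mult norm_of_real using \<psi>0 by (simp add: mult_left_mono)
      qed
      have att: "cell_attained d u'"
        unfolding cell_attained_def
      proof (intro conjI allI impI)
        show "0 \<le> u' j" for j using \<psi>0 u0 by (simp add: u'_def)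
        fix j assume "u' j \<noteq> 0"
        then obtain l where l: "l \<in> \<Lambda>" "vceiling l = j" "u j \<le> norm (c l)"
          using u(2) by (auto simp: cell_attained_def u'_def)
        then have "u' j \<le> norm (d l)"
          unfolding d_def u'_def norm_mult norm_of_real using \<psi>0 by (simp add: mult_left_mono)
        with l show "\<exists>l\<in>\<Lambda>. vceiling l = j \<and> u' j \<le> norm (d l)" by blast
      qed
      \<comment> \<open>Although \<open>c\<close> is controlled only in l^q, its cell maxima are
        bounded and the window is summable. The windowed coefficients are therefore in l^1, hence in
        l^p, and p-stability applies to them.\<close>
      have "u' summable_on UNIV"
        unfolding u'_def
        by (rule summable_on_mult_bounded[where B = S]) (use \<psi>0 s\<psi> infsum_shift(3)[of ?\<psi> n] u0 uS in auto)
      then have lu': "lq_bounded p u' (infsum u' UNIV)"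
        using dom by (intro lq_bounded_l1 p) (auto simp: cell_dominated_def)
      have u'B: "u' j \<le> infsum u' UNIV" for j
        using lq_bounded_point[OF lu' p, of j] by simp
      have "Lp_norm (count_space \<Lambda>) p d < \<infinity>"
        using Lp_norm_le_cell_dominated[OF p dom lu'] by (simp add: order_le_less_trans)
      then have "ennreal (inverse C) * Lp_norm (count_space \<Lambda>) p d \<le> Lp_norm lborel p (synth d)"
        by (intro lower) (simp add: Lp_space_def)
      also have "\<dots> \<le> ennreal T"
      proof (rule Lp_norm_synth_le[OF p dom u'B _ _ v])
        show "0 \<le> v k" for k
          unfolding v_def using \<psi>0 h u0 W by (intro add_nonneg_nonneg mult_nonneg_nonneg infsum_nonneg) auto
        fix x
        have "norm (synth d x) \<le> \<bar>?\<psi> (vfloor x - n)\<bar> * norm (synth c x)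
            + (\<Sum>\<^sub>\<infinity>j. real R * W (vfloor x - j) * \<bar>?\<psi> (j - n) - ?\<psi> (vfloor x - n)\<bar> * u j)"
          unfolding d_def using synth_window[OF u(1) uS, of "\<lambda>j. ?\<psi> (j - n)" x] \<psi>1 by simp
        also have "\<dots> \<le> v (vfloor x)"
          unfolding v_def using \<psi>0 h(2) by (simp add: mult_left_mono)
        finally show "norm (synth d x) \<le> v (vfloor x)" .
      qed
      finally have "ennreal C * (ennreal (inverse C) * Lp_norm (count_space \<Lambda>) p d) \<le> ennreal C * ennreal T"
        by (rule mult_left_mono) simp
      then have "Lp_norm (count_space \<Lambda>) p d \<le> ennreal (C * T)"
        using C lq_bounded_nonneg[OF v]
        by (simp add: mult.assoc[symmetric] ennreal_mult'[symmetric])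
      then have "lq_bounded p u' (C * T)"
        by (rule lq_bounded_if_cell_attained[OF p _ _ att]) (use C lq_bounded_nonneg[OF v] in simp)
      then show "lq_bounded p (\<lambda>k. ?\<psi> (k - n) * u k) (C * T)"
        by (simp add: u'_def[abs_def])
    qed (use W C u0 u h in auto)
    then show "lq_bounded q u (K * F)" by (simp add: K_def mult_ac)
  qed
qed

text \<open>The majorant is now taken to be the cellwise supremum \<open>h\<close>. Near a point
  where half of it is reached, the synthesized function is at least \<open>h k / 2\<close> minus an
  oscillation, on a set of measure at least \<theta>. The oscillation is a convolution of
  \<open>u\<close> with a kernel of small mass.\<close>

lemma synth_lower_bound:
  assumes p: "1 \<le> p" and q: "1 \<le> q" and stable: "lp_stable \<Lambda> \<phi> p"
  obtains K where "0 \<le> K"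
    "\<And>c u S T. cell_dominated c u \<Longrightarrow> cell_attained c u \<Longrightarrow> lq_bounded q u S \<Longrightarrow>
      0 \<le> T \<Longrightarrow> Lp_norm lborel q (synth c) \<le> ennreal T \<Longrightarrow> lq_bounded q u (K * T)"
proof -
  obtain K where K: "0 \<le> K" and localized:
    "\<And>c u h S F. cell_dominated c u \<Longrightarrow> cell_attained c u \<Longrightarrow> lq_bounded q u S \<Longrightarrow>
      (\<And>k. 0 \<le> h k) \<Longrightarrow> (\<And>x. norm (synth c x) \<le> h (vfloor x)) \<Longrightarrow> lq_bounded q h F \<Longrightarrow>
      lq_bounded q u (K * F)"
    by (rule localized_lower_bound[OF p q stable]) blast
  \<comment> \<open>With this \<epsilon> the oscillation returns to the bound for \<open>u\<close>
    with a factor at most 1/2, as absorption requires; the summand 1 keeps \<open>D\<close>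
    positive.\<close>
  define D where "D = K * real R + 1"
  define \<epsilon> where "\<epsilon> = 1 / (4 * D)"
  have pos: "0 < D" using K by (simp add: D_def add_nonneg_pos)
  have "K * (2 * (real R * \<epsilon>)) = K * real R / D / 2"
    by (simp add: \<epsilon>_def)
  also have "\<dots> \<le> 1 / 2"
    using pos by (intro divide_right_mono) (simp_all add: divide_le_eq D_def)
  finally have \<epsilon>: "0 < \<epsilon>" "K * (2 * (real R * \<epsilon>)) \<le> 1 / 2"
    using pos by (simp_all add: \<epsilon>_def)
  from equicontinuous[OF \<epsilon>(1)] obtain \<delta> V where \<delta>: "0 < \<delta>"
    and V: "\<And>k. 0 \<le> V k" "V summable_on UNIV" "infsum V UNIV \<le> \<epsilon>"
    and \<phi>V: "\<And>l x y. l \<in> \<Lambda> \<Longrightarrow> norm y \<le> \<delta> \<Longrightarrow> norm (\<phi> l (x + y) - \<phi> l x) \<le> V (vfloor x - vceiling l)"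
    by blast
  obtain \<theta> where \<theta>: "0 < \<theta>" "\<theta> \<le> 1"
    "\<And>x :: real ^ 'd. ennreal \<theta> \<le> emeasure lborel {y. vfloor y = vfloor x \<and> norm (y - x) \<le> \<delta>}"
    "\<And>x :: real ^ 'd. {y. vfloor y = vfloor x \<and> norm (y - x) \<le> \<delta>} \<in> sets lborel"
    by (rule emeasure_cell_near_point[OF \<delta>, where 'd = 'd]) blast
  show ?thesis
  proof (rule that[of "2 * (K * (2 / \<theta>))"])
    show "0 \<le> 2 * (K * (2 / \<theta>))" using K \<theta> by simp
    fix c u S T
    assume u: "cell_dominated c u" "cell_attained c u" "lq_bounded q u S"
      and T: "0 \<le> T" "Lp_norm lborel q (synth c) \<le> ennreal T"
    have u0: "0 \<le> u j" for j using u by (simp add: cell_dominated_def)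
    have uS: "u j \<le> S" for j using lq_bounded_point[OF u(3) q, of j] by simp
    define h where "h k = (SUP x\<in>vfloor -` {k}. norm (synth c x))" for k
    have bdd: "bdd_above ((\<lambda>x. norm (synth c x)) ` X)" for X
    proof (rule bdd_aboveI2)
      fix x
      have "norm (synth c x) \<le> real R * (\<Sum>\<^sub>\<infinity>j. u j * W (vfloor x - j))"
        by (rule norm_synth_le[OF u(1) uS])
      also have "\<dots> \<le> real R * (infsum W UNIV * S)"
        by (intro mult_left_mono convolution_sup_bound W u0 uS) simp
      finally show "norm (synth c x) \<le> real R * (infsum W UNIV * S)" .
    qed
    have nonempty: "vfloor -` {k} \<noteq> {}" for k :: "int ^ 'd"
    proof -
      have "vfloor (vreal k) = k" by (simp add: vfloor_def vreal_def vec_eq_iff)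
      then show ?thesis by auto
    qed
    have h: "norm (synth c x) \<le> h (vfloor x)" for x
      unfolding h_def by (rule cSUP_upper[OF _ bdd]) simp
    have h0: "0 \<le> h k" for k
      using nonempty[of k] h norm_ge_zero order_trans by blast
    \<comment> \<open>The supremum need not be attained, but half of it is exceeded when it is
      positive; when it is zero any point of the cell serves.\<close>
    have "\<exists>x. vfloor x = k \<and> h k \<le> 2 * norm (synth c x)" for k
    proof (cases "h k = 0")
      case True
      then show ?thesis using nonempty[of k] by auto
    next
      case False
      then have "h k / 2 < h k" using h0[of k] by simp
      then obtain x where "x \<in> vfloor -` {k}" "h k / 2 < norm (synth c x)"
        unfolding h_def less_cSUP_iff[OF nonempty bdd] by blast
      then show ?thesis by (intro exI[of _ x]) auto
    qed
    then obtain x where x: "\<And>k. vfloor (x k) = k" "\<And>k. h k \<le> 2 * norm (synth c (x k))"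
      by metis
    define osc where "osc k = real R * (\<Sum>\<^sub>\<infinity>j. u j * V (k - j))" for k
    have osc0: "0 \<le> osc k" for k
      unfolding osc_def using u0 V by (intro mult_nonneg_nonneg infsum_nonneg) auto
    \<comment> \<open>Truncation at 0 because \<open>lq_bounded_if_Lp_norm_le\<close> takes
      nonnegative sequences; where the oscillation exceeds \<open>h k / 2\<close> nothing is
      claimed.\<close>
    define g where "g k = max 0 (h k / 2 - osc k)" for k
    have "lq_bounded q g (T / \<theta>)"
    proof (rule lq_bounded_if_Lp_norm_le[OF q T(2,1) \<theta>(1,2),
          where E = "\<lambda>k. {y. vfloor y = vfloor (x k) \<and> norm (y - x k) \<le> \<delta>}"])
      show "{y. vfloor y = vfloor (x k) \<and> norm (y - x k) \<le> \<delta>} \<inter>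
          {y. vfloor y = vfloor (x l) \<and> norm (y - x l) \<le> \<delta>} = {}" if "k \<noteq> l" for k l
        using that by (auto simp: x(1))
      fix k y assume y: "y \<in> {y. vfloor y = vfloor (x k) \<and> norm (y - x k) \<le> \<delta>}"
      have "norm (synth c (x k + (y - x k)) - synth c (x k)) \<le> osc (vfloor (x k))"
        unfolding osc_def by (rule norm_synth_diff_le[OF u(1) uS V(1,2) \<phi>V]) (use y in auto)
      then have "norm (synth c y - synth c (x k)) \<le> osc k"
        by (simp add: x(1))
      then have "norm (synth c (x k)) \<le> norm (synth c y) + osc k"
        using norm_triangle_sub[of "synth c (x k)" "synth c y"] by (simp add: norm_minus_commute)
      then have "h k / 2 - osc k \<le> norm (synth c y)"
        using x(2)[of k] by linarith
      then show "g k \<le> norm (synth c y)" by (simp add: g_def)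
    qed (use \<theta>(3,4) in \<open>auto simp: g_def\<close>)
    note g = this
    \<comment> \<open>The constants \<epsilon> and \<theta> were fixed before \<open>c\<close>, so
      every bound \<open>S'\<close> for \<open>u\<close> can be improved by the same step.\<close>
    have "lq_bounded q u (2 * (K * (2 / \<theta> * T)))"
    proof (rule lq_bounded_absorb[OF q u(3)])
      show "0 \<le> K * (2 / \<theta> * T)" using K \<theta> T by simp
      fix S' assume S': "lq_bounded q u S'"
      have "lq_bounded q osc (real R * (\<epsilon> * S'))"
        unfolding osc_def
      proof (intro lq_bounded_cmult q)
        show "lq_bounded q (\<lambda>k. \<Sum>\<^sub>\<infinity>j. u j * V (k - j)) (\<epsilon> * S')"
          by (rule lq_bounded_mono[OF lq_bounded_convolution[OF q S' V(1,2)] q])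
            (use V lq_bounded_nonneg[OF S'] in \<open>auto intro: mult_right_mono\<close>)
      qed simp
      then have "lq_bounded q (\<lambda>k. 2 * (g k + osc k)) (2 * (T / \<theta> + real R * (\<epsilon> * S')))"
        by (intro lq_bounded_cmult lq_bounded_add g q) auto
      then have hb: "lq_bounded q h (2 * (T / \<theta> + real R * (\<epsilon> * S')))"
      proof (rule lq_bounded_mono[OF _ q])
        show "\<bar>h k\<bar> \<le> \<bar>2 * (g k + osc k)\<bar>" for k
        proof -
          have "h k / 2 - osc k \<le> g k" by (simp add: g_def)
          then have "h k \<le> 2 * (g k + osc k)" by simp
          then show ?thesis using h0[of k] by linarith
        qed
      qed simp
      have "lq_bounded q u (K * (2 * (T / \<theta> + real R * (\<epsilon> * S'))))"
        by (rule localized[OF u h0 h hb])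
      then show "lq_bounded q u (K * (2 / \<theta> * T) + S' / 2)"
      proof (rule lq_bounded_mono[OF _ q])
        have "K * (2 * (real R * \<epsilon>)) * S' \<le> 1 / 2 * S'"
          by (rule mult_right_mono[OF \<epsilon>(2) lq_bounded_nonneg[OF S']])
        then show "K * (2 * (T / \<theta> + real R * (\<epsilon> * S'))) \<le> K * (2 / \<theta> * T) + S' / 2"
          by (simp add: algebra_simps)
      qed simp
    qed
    then show "lq_bounded q u (2 * (K * (2 / \<theta>)) * T)" by (simp add: mult_ac)
  qed
qed

lemma lp_stable_transfer:
  assumes p: "1 \<le> p" and q: "1 \<le> q" and stable: "lp_stable \<Lambda> \<phi> p"
  shows "lp_stable \<Lambda> \<phi> q"
proof -
  obtain K where K: "0 \<le> K" and lower:
    "\<And>c u S T. cell_dominated c u \<Longrightarrow> cell_attained c u \<Longrightarrow> lq_bounded q u S \<Longrightarrow>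
      0 \<le> T \<Longrightarrow> Lp_norm lborel q (synth c) \<le> ennreal T \<Longrightarrow> lq_bounded q u (K * T)"
    by (rule synth_lower_bound[OF p q stable]) blast
  \<comment> \<open>Majorizes the constants of both estimates, including the factor \<open>R\<close>
    lost when passing from cell maxima back to coefficients; the 1 ensures positivity.\<close>
  define C where "C = max 1 (max (real R * infsum W UNIV) (real R * K))"
  have C: "1 \<le> C" "real R * infsum W UNIV \<le> C" "real R * K \<le> C"
    by (auto simp: C_def)
  show ?thesis
    unfolding lp_stable_def
  proof (intro exI[of _ C] conjI ballI)
    show "0 < C" using C by simp
    fix c assume "c \<in> Lp_space (count_space \<Lambda>) q"
    then obtain S where S: "0 \<le> S" "Lp_norm (count_space \<Lambda>) q c = ennreal S"
      by (cases "Lp_norm (count_space \<Lambda>) q c") (auto simp: Lp_space_def)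
    obtain u where u: "cell_dominated c u" "cell_attained c u"
      by (rule cell_maximum_exists)
    have uS: "lq_bounded q u S"
      by (rule lq_bounded_if_cell_attained[OF q _ S(1) u(2)]) (simp add: S)
    have "Lp_norm lborel q (synth c) \<le> ennreal (real R * (infsum W UNIV * S))"
      by (rule synth_upper_bound[OF q u(1) uS])
    also have "\<dots> \<le> ennreal (C * S)"
      using mult_right_mono[OF C(2) S(1)] by (intro ennreal_leI) (simp add: mult_ac)
    also have "\<dots> = ennreal C * Lp_norm (count_space \<Lambda>) q c"
      using C S by (simp add: ennreal_mult)
    finally show upper: "Lp_norm lborel q (synth c) \<le> ennreal C * Lp_norm (count_space \<Lambda>) q c" .
    \<comment> \<open>The upper estimate makes this norm a real number \<open>T\<close>, to which
      the lower estimate can be applied.\<close>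
    then have "Lp_norm lborel q (synth c) < \<infinity>"
      unfolding S(2) by (rule order_le_less_trans) (simp add: ennreal_mult_less_top)
    then obtain T where T: "0 \<le> T" "Lp_norm lborel q (synth c) = ennreal T"
      by (cases "Lp_norm lborel q (synth c)") auto
    have "lq_bounded q u (K * T)"
      by (rule lower[OF u uS T(1)]) (simp add: T)
    then have "Lp_norm (count_space \<Lambda>) q c \<le> ennreal (real R * (K * T))"
      by (rule Lp_norm_le_cell_dominated[OF q u(1)])
    also have "\<dots> \<le> ennreal (C * T)"
      using mult_right_mono[OF C(3) T(1)] by (intro ennreal_leI) (simp add: mult_ac)
    finally have "ennreal (inverse C) * Lp_norm (count_space \<Lambda>) q c \<le> ennreal (inverse C) * ennreal (C * T)"
      by (rule mult_left_mono) simp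
    also have "\<dots> = ennreal T"
      using C T by (simp add: ennreal_mult'[symmetric] mult.assoc[symmetric])
    finally show "ennreal (inverse C) * Lp_norm (count_space \<Lambda>) q c \<le> Lp_norm lborel q (synth c)"
      by (simp add: T)
  qed
qed

end

section \<open>Reduction of the continuous hypotheses to the discrete ones\<close>

theorem theorem3p1:
  fixes \<Lambda> :: "(real ^ 'd) set"
    and \<phi> :: "real ^ 'd \<Rightarrow> real ^ 'd \<Rightarrow> complex"
    and p q :: ennreal
  assumes "relatively_separated \<Lambda>"
    and "wiener_amalgam_norm (\<lambda>x. SUP l\<in>\<Lambda>. ennreal (norm (\<phi> l (x + l)))) < \<infinity>"
    and "((\<lambda>\<delta>. wiener_amalgam_norm (\<lambda>x. SUP l\<in>\<Lambda>. modulus_of_continuity \<delta> (\<phi> l) (x + l)))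
            \<longlongrightarrow> 0) (at_right 0)"
    and "1 \<le> p" and "lp_stable \<Lambda> \<phi> p"
    and "1 \<le> q"
  shows "lp_stable \<Lambda> \<phi> q"
proof -
  obtain R where R: "1 \<le> R" "\<And>j. finite {l\<in>\<Lambda>. vceiling l = j}" "\<And>j. card {l\<in>\<Lambda>. vceiling l = j} \<le> R"
    by (rule relatively_separated_fibres[OF assms(1)]) blast
  obtain a where a: "0 \<le> a" "wiener_amalgam_norm (\<lambda>x. SUP l\<in>\<Lambda>. ennreal (norm (\<phi> l (x + l)))) = ennreal a"
    using assms(2) by (cases "wiener_amalgam_norm (\<lambda>x. SUP l\<in>\<Lambda>. ennreal (norm (\<phi> l (x + l))))") auto
  obtain W where W: "\<And>k. 0 \<le> W k" "W summable_on UNIV"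
    "\<And>x l'. (SUP l\<in>\<Lambda>. ennreal (norm (\<phi> l (x - l' + l)))) \<le> ennreal (W (vfloor x - vceiling l'))"
    by (rule wiener_amalgam_translates[OF eq_refl[OF a(2)] a(1)]) blast
  interpret localized_family \<Lambda> \<phi> R W
  proof
    show "norm (\<phi> l x) \<le> W (vfloor x - vceiling l)" if "l \<in> \<Lambda>" for l x
    proof -
      have "ennreal (norm (\<phi> l (x - l + l))) \<le> (SUP l'\<in>\<Lambda>. ennreal (norm (\<phi> l' (x - l + l'))))"
        using that by (rule SUP_upper)
      also note W(3)
      finally show ?thesis using W(1) by simp
    qed
    fix \<epsilon> :: real assume \<epsilon>: "0 < \<epsilon>"
    \<comment> \<open>The number of unit corners is the factor lost in
      \<open>wiener_amalgam_translates\<close>; dividing \<epsilon> by \<open>D\<close> compensates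
      for it, and the added 1 makes \<open>D\<close> positive at once.\<close>
    define D where "D = real (card (unit_corners :: (int ^ 'd) set)) + 1"
    have D: "0 < D" by (simp add: D_def)
    have "\<forall>\<^sub>F \<delta> in at_right 0. wiener_amalgam_norm (\<lambda>x. SUP l\<in>\<Lambda>. modulus_of_continuity \<delta> (\<phi> l) (x + l))
        < ennreal (\<epsilon> / D)"
      using assms(3) by (rule order_tendstoD) (use \<epsilon> D in simp)
    then obtain b where b: "0 < b" "\<And>\<delta>. 0 < \<delta> \<Longrightarrow> \<delta> < b \<Longrightarrow>
        wiener_amalgam_norm (\<lambda>x. SUP l\<in>\<Lambda>. modulus_of_continuity \<delta> (\<phi> l) (x + l)) < ennreal (\<epsilon> / D)"
      unfolding eventually_at_right_field by auto
    define \<delta> where "\<delta> = b / 2"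
    have \<delta>: "0 < \<delta>" "wiener_amalgam_norm (\<lambda>x. SUP l\<in>\<Lambda>. modulus_of_continuity \<delta> (\<phi> l) (x + l)) \<le> ennreal (\<epsilon> / D)"
      using b(1) b(2)[of \<delta>] by (auto simp: \<delta>_def intro: less_imp_le)
    have "0 \<le> \<epsilon> / D" using \<epsilon> D by simp
    then obtain V where V: "\<And>k. 0 \<le> V k" "V summable_on UNIV"
      "infsum V UNIV \<le> real (card (unit_corners :: (int ^ 'd) set)) * (\<epsilon> / D)"
      "\<And>x l'. (SUP l\<in>\<Lambda>. modulus_of_continuity \<delta> (\<phi> l) (x - l' + l)) \<le> ennreal (V (vfloor x - vceiling l'))"
      by (rule wiener_amalgam_translates[OF \<delta>(2)]) blast
    have "real (card (unit_corners :: (int ^ 'd) set)) * (\<epsilon> / D) \<le> D * (\<epsilon> / D)"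
      using \<epsilon> D by (intro mult_right_mono) (auto simp: D_def)
    then have "infsum V UNIV \<le> \<epsilon>" using V(3) D by simp
    moreover have "norm (\<phi> l (x + y) - \<phi> l x) \<le> V (vfloor x - vceiling l)"
      if "l \<in> \<Lambda>" "norm y \<le> \<delta>" for l x y
    proof -
      \<comment> \<open>The amalgam hypothesis evaluates each function relative to its own point
        \<open>l\<close>, so it is used at \<open>x - l\<close>, where the term of index
        \<open>l\<close> is taken at \<open>x\<close>.\<close>
      have "ennreal (norm (\<phi> l (x + y) - \<phi> l x)) \<le> modulus_of_continuity \<delta> (\<phi> l) (x - l + l)"
        unfolding modulus_of_continuity_def using that(2) by (auto intro!: SUP_upper2[of y])
      also have "\<dots> \<le> (SUP l'\<in>\<Lambda>. modulus_of_continuity \<delta> (\<phi> l') (x - l + l'))"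
        using that(1) by (rule SUP_upper)
      also note V(4)
      finally show ?thesis using V(1) by simp
    qed
    ultimately show "\<exists>\<delta>>0. \<exists>V. (\<forall>k. 0 \<le> V k) \<and> V summable_on UNIV \<and> infsum V UNIV \<le> \<epsilon> \<and>
        (\<forall>l\<in>\<Lambda>. \<forall>x y. norm y \<le> \<delta> \<longrightarrow> norm (\<phi> l (x + y) - \<phi> l x) \<le> V (vfloor x - vceiling l))"
      using \<delta>(1) V(1,2) by blast
  qed (use R W in auto)
  show ?thesis
    using assms(4,6,5) by (rule lp_stable_transfer)
qed

end
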